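(* Let $k$ be a field, let $\Gamma=\langle x,y : [[x,y],x]=[[x,y],y]=1\rangle$ be the Heisenberg group, and let $D$ be the (Ore) division ring of fractions of the group algebra $k\Gamma$. Let $\ast$ be a $k$-involution of $D$ which is induced from an involution on $\Gamma$. Then $D$ contains a free $k$-algebra of rank $2$ freely generated by symmetric elements; that is, there exist two elements $u,v\in D$ with $u^{\ast}=u$ and $v^{\ast}=v$ which freely generate a free (associative, unital) $k$-subalgebra of $D$.
   Context: For elements $g,h$ of a group, $[g,h]=g^{-1}h^{-1}gh$. The Heisenberg group is the free nilpotent group of class $2$ on two generators. An involution on a group $\Gamma$ is a map $\ast\colon\Gamma\to\Gamma$ with $(gh)^{\ast}=h^{\ast}g^{\ast}$ and $g^{\ast\ast}=g$ for all $g,h\in\Gamma$. A $k$-involution on a $k$-algebra $D$ is a $k$-linear map $\ast\colon D\to D$ satisfying $(ab)^{\ast}=b^{\ast}a^{\ast}$ and $a^{\ast\ast}=a$ for all $a,b\in D$. An element $a\in D$ is symmetric with respect to $\ast$ if $a^{\ast}=a$. The group algebra $k\Gamma$ is a noetherian domain, hence an Ore domain, with division ring of fractions $D$. An involution on $\Gamma$ extends $k$-linearly to a $k$-involution of $k\Gamma$, which extends uniquely to a $k$-involution of $D$; this is the $k$-involution of $D$ induced from the involution on $\Gamma$. *)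

theory Defs
  imports Complex_Main "HOL-Library.Poly_Mapping"
begin

section \<open>The Heisenberg group\<close>

text \<open>
  The group presented by two generators and the relations
  \<open>[[x,y],x] = [[x,y],y] = 1\<close>: group terms in two letters, modulo the least
  congruence that contains the group laws and the two relations.
\<close>

datatype heis_term =
  GenX | GenY | GOne | GMult heis_term heis_term | GInv heis_term

definition comm_term :: "heis_term \<Rightarrow> heis_term \<Rightarrow> heis_term" where
  "comm_term g h = GMult (GMult (GMult (GInv g) (GInv h)) g) h"

inductive heis_eq :: "heis_term \<Rightarrow> heis_term \<Rightarrow> bool" where
  refl: "heis_eq s s"
| sym: "heis_eq s t \<Longrightarrow> heis_eq t s"
| trans: "heis_eq s t \<Longrightarrow> heis_eq t u \<Longrightarrow> heis_eq s u"
| mult_cong: "heis_eq s s' \<Longrightarrow> heis_eq t t' \<Longrightarrow> heis_eq (GMult s t) (GMult s' t')"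
| inv_cong: "heis_eq s s' \<Longrightarrow> heis_eq (GInv s) (GInv s')"
| assoc: "heis_eq (GMult (GMult s t) u) (GMult s (GMult t u))"
| one_left: "heis_eq (GMult GOne s) s"
| one_right: "heis_eq (GMult s GOne) s"
| inv_left: "heis_eq (GMult (GInv s) s) GOne"
| rel_x: "heis_eq (comm_term (comm_term GenX GenY) GenX) GOne"
| rel_y: "heis_eq (comm_term (comm_term GenX GenY) GenY) GOne"

quotient_type heis = heis_term / heis_eq
  by (rule equivpI)
     (auto simp: reflp_def symp_def transp_def intro: heis_eq.refl heis_eq.sym heis_eq.trans)

text \<open>
  The non-commutative group class \<^class>\<open>group_add\<close> is written additively, so groups
  are written additively below: \<open>g + h\<close> is the product \<open>gh\<close>,
  \<open>- g\<close> is \<open>g\<inverse>\<close> and \<open>0\<close> is \<open>1\<close>.  Addition on \<open>heis\<close> is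
  not commutative.
\<close>

instantiation heis :: group_add
begin

lift_definition zero_heis :: heis is GOne .
lift_definition plus_heis :: "heis \<Rightarrow> heis \<Rightarrow> heis" is GMult by (rule heis_eq.mult_cong)
lift_definition uminus_heis :: "heis \<Rightarrow> heis" is GInv by (rule heis_eq.inv_cong)
definition minus_heis :: "heis \<Rightarrow> heis \<Rightarrow> heis" where "minus_heis g h = g + - h"

instance
proof
  fix a b c :: heis
  show "a + b + c = a + (b + c)" by transfer (rule heis_eq.assoc)
  show "0 + a = a" by transfer (rule heis_eq.one_left)
  show "a + 0 = a" by transfer (rule heis_eq.one_right)
  show "- a + a = 0" by transfer (rule heis_eq.inv_left)
  show "a + - b = a - b" by (simp add: minus_heis_def)
qed

end

definition group_involution :: "('g::group_add \<Rightarrow> 'g) \<Rightarrow> bool" where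
  "group_involution \<tau> \<longleftrightarrow> (\<forall>g h. \<tau> (g + h) = \<tau> h + \<tau> g) \<and> (\<forall>g. \<tau> (\<tau> g) = g)"


section \<open>Algebras over a field\<close>

locale k_algebra = vector_space scale
  for scale :: "'k::field \<Rightarrow> 'a::ring_1 \<Rightarrow> 'a" +
  assumes scale_mult_left: "scale c (a * b) = scale c a * b"
    and scale_mult_right: "scale c (a * b) = a * scale c b"

definition k_algebra_hom ::
  "('k::field \<Rightarrow> 'a::ring_1 \<Rightarrow> 'a) \<Rightarrow> ('k \<Rightarrow> 'b::ring_1 \<Rightarrow> 'b) \<Rightarrow> ('a \<Rightarrow> 'b) \<Rightarrow> bool" where
  "k_algebra_hom s1 s2 f \<longleftrightarrow>
     k_algebra s1 \<and> k_algebra s2 \<and> Vector_Spaces.linear s1 s2 f \<and>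
     f 1 = 1 \<and> (\<forall>a b. f (a * b) = f a * f b)"

definition k_involution :: "('k::field \<Rightarrow> 'a::ring_1 \<Rightarrow> 'a) \<Rightarrow> ('a \<Rightarrow> 'a) \<Rightarrow> bool" where
  "k_involution scale star \<longleftrightarrow>
     Vector_Spaces.linear scale scale star \<and>
     (\<forall>a b. star (a * b) = star b * star a) \<and> (\<forall>a. star (star a) = a)"


section \<open>Monoid algebras\<close>

text \<open>
  For a monoid \<open>'m\<close> (written additively), the ring \<open>'m \<Rightarrow>\<^sub>0 'k\<close> of finitely supported
  functions under convolution is the monoid algebra of \<open>'m\<close> over \<open>'k\<close>, with basis
  \<open>Poly_Mapping.single m 1\<close>.
\<close>

definition pm_scale :: "'k::field \<Rightarrow> ('m \<Rightarrow>\<^sub>0 'k) \<Rightarrow> ('m \<Rightarrow>\<^sub>0 'k)" where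
  "pm_scale c = Poly_Mapping.map ((*) c)"

definition pm_extend :: "('k::field \<Rightarrow> 'a::ab_group_add \<Rightarrow> 'a) \<Rightarrow> ('m \<Rightarrow> 'a) \<Rightarrow> ('m \<Rightarrow>\<^sub>0 'k) \<Rightarrow> 'a" where
  "pm_extend scale f p =
     (\<Sum>m\<in>Poly_Mapping.keys p. scale (Poly_Mapping.lookup p m) (f m))"


section \<open>Free algebras\<close>

text \<open>
  The free monoid on \<open>'x\<close>, as a copy of the lists over \<open>'x\<close>, so that it can be a
  \<^class>\<open>monoid_add\<close>.  Its monoid algebra is the free associative unital algebra on \<open>'x\<close>.
\<close>

datatype 'x free_monoid = Word (letters: "'x list")

instantiation free_monoid :: (type) monoid_add
begin

definition zero_free_monoid :: "'a free_monoid" where "0 = Word []"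
definition plus_free_monoid :: "'a free_monoid \<Rightarrow> 'a free_monoid \<Rightarrow> 'a free_monoid" where
  "v + w = Word (letters v @ letters w)"

instance
  by standard (simp_all add: zero_free_monoid_def plus_free_monoid_def)

end

definition free_algebra_eval ::
  "('k::field \<Rightarrow> 'a::ring_1 \<Rightarrow> 'a) \<Rightarrow> ('x \<Rightarrow> 'a) \<Rightarrow> ('x free_monoid \<Rightarrow>\<^sub>0 'k) \<Rightarrow> 'a" where
  "free_algebra_eval scale a = pm_extend scale (\<lambda>w. prod_list (map a (letters w)))"

definition freely_generate_pair :: "('k::field \<Rightarrow> 'a::ring_1 \<Rightarrow> 'a) \<Rightarrow> 'a \<Rightarrow> 'a \<Rightarrow> bool" where
  "freely_generate_pair scale u v \<longleftrightarrow>
     inj (free_algebra_eval scale (\<lambda>b::bool. if b then u else v))"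


section \<open>Division rings of fractions of group algebras\<close>

text \<open>
  A division ring of fractions of the group algebra of \<open>'g\<close> over \<open>'k\<close>: a division ring
  \<open>'d\<close> that is a \<open>'k\<close>-algebra, with an injective algebra homomorphism \<open>\<iota>\<close> into it such
  that every element is a right fraction.  This determines \<open>'d\<close> and \<open>\<iota>\<close> up to a unique
  isomorphism.
\<close>

definition ore_fractions ::
  "('k::field \<Rightarrow> 'd::division_ring \<Rightarrow> 'd) \<Rightarrow> (('g::group_add \<Rightarrow>\<^sub>0 'k) \<Rightarrow> 'd) \<Rightarrow> bool" where
  "ore_fractions scale \<iota> \<longleftrightarrow>
     k_algebra_hom pm_scale scale \<iota> \<and> inj \<iota> \<and>
     (\<forall>d. \<exists>a b. b \<noteq> 0 \<and> d = \<iota> a * inverse (\<iota> b))"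

definition induced_involution ::
  "('k::field \<Rightarrow> 'd::division_ring \<Rightarrow> 'd) \<Rightarrow> (('g::group_add \<Rightarrow>\<^sub>0 'k) \<Rightarrow> 'd) \<Rightarrow> ('d \<Rightarrow> 'd) \<Rightarrow> bool" where
  "induced_involution scale \<iota> star \<longleftrightarrow>
     k_involution scale star \<and>
     (\<exists>\<tau>. group_involution \<tau> \<and>
        (\<forall>p. star (\<iota> p) = \<iota> (pm_extend pm_scale (\<lambda>g. Poly_Mapping.single (\<tau> g) 1) p)))"

end

theory Submission
  imports Defs "HOL-Computational_Algebra.Polynomial_Factorial"
begin

text \<open>
  Let \<open>\<tau>\<close> be the involution of the Heisenberg group.  Some \<open>x, y\<close> with independent images in the
  abelianization satisfy \<open>\<tau> x = x\<^sup>\<plusminus>\<^sup>1\<close> and \<open>\<tau> y = y\<^sup>\<plusminus>\<^sup>1\<close>, so \<open>u = x / (1 - x)\<^sup>2\<close> and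
  \<open>v = y / (1 - y)\<^sup>2\<close> are symmetric.  Let \<open>w\<close> be the central commutator of \<open>y\<close> and \<open>x\<close>, let
  \<open>F = k(w)(x)\<close>, and let \<open>\<sigma>\<close> be the automorphism \<open>x \<mapsto> w x\<close> of \<open>F\<close>, which is conjugation by
  \<open>y\<close>.  With \<open>B = 1 / (1 - y)\<close> we have \<open>u \<in> F\<close> and \<open>v = B\<^sup>2 - B\<close>.  The words
  \<open>B u\<^sup>i B u\<^sup>j \<dots> B\<close> are left linearly independent over \<open>F\<close>: since \<open>y B = B - 1\<close>, comparing a
  shortest relation with its product by \<open>y\<close> produces an equation \<open>\<Sum> c\<^sub>i u\<^sup>i = \<sigma> g - g\<close> with constants \<open>c\<^sub>i\<close>, not all
  zero.  This is impossible, because the left-hand side has its only pole in the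
  \<open>\<sigma>\<close>-orbit of \<open>x = 1\<close> at \<open>x = 1\<close> itself, unless it is a nonzero constant, which is not of the form
  \<open>\<sigma> g - g\<close> either.  A leading term argument passes from these words to words in \<open>u\<close> and \<open>v\<close>.
\<close>


section \<open>Homomorphisms from polynomials and fractions into division rings\<close>

locale unital_hom =
  fixes f :: "'a::ring_1 \<Rightarrow> 'b::ring_1"
  assumes one: "f 1 = 1"
    and add: "f (a + b) = f a + f b"
    and mult: "f (a * b) = f a * f b"
begin

lemma zero: "f 0 = 0"
  using add[of 0 0] by simp

lemma uminus: "f (- a) = - f a"
  using add[of a "- a"] zero by (simp add: eq_neg_iff_add_eq_0 add.commute)

lemma diff: "f (a - b) = f a - f b"
  using add[of a "- b"] by (simp add: uminus)

lemma sum: "f (sum g S) = (\<Sum>i\<in>S. f (g i))"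
  by (induction S rule: infinite_finite_induct) (simp_all add: zero add)

end

lemma unital_hom_inverse:
  fixes f :: "'a::field \<Rightarrow> 'b::division_ring"
  assumes "unital_hom f"
  shows "f (inverse a) = inverse (f a)"
proof (cases "a = 0")
  case True
  then show ?thesis by (simp add: unital_hom.zero[OF assms])
next
  case False
  then have "f (inverse a) * f a = 1"
    using unital_hom.mult[OF assms, of "inverse a" a] by (simp add: unital_hom.one[OF assms])
  then have "inverse (f (inverse a)) = f a" by (rule inverse_unique)
  then show ?thesis using inverse_inverse_eq[of "f (inverse a)"] by simp
qed

lemma commute_inverse:
  fixes a b :: "'a::division_ring"
  assumes "a * b = b * a"
  shows "a * inverse b = inverse b * a"
proof (cases "b = 0")
  case False
  have "a * inverse b = inverse b * (b * a) * inverse b"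
    using False by (simp add: mult.assoc[symmetric])
  also have "\<dots> = inverse b * (a * b) * inverse b"
    using assms by simp
  also have "\<dots> = inverse b * a" using False by (simp add: mult.assoc)
  finally show ?thesis .
qed simp

text \<open>The conclusion concerns the coefficients before \<open>\<phi>\<close> is applied, so
  independence includes injectivity of \<open>\<phi>\<close>.\<close>

definition left_indep :: "('a::zero \<Rightarrow> 'd::ring) \<Rightarrow> ('i \<Rightarrow> 'd) \<Rightarrow> bool" where
  "left_indep \<phi> m \<longleftrightarrow>
     (\<forall>S c. finite S \<longrightarrow> (\<Sum>i\<in>S. \<phi> (c i) * m i) = 0 \<longrightarrow> (\<forall>i\<in>S. c i = 0))"

lemma left_indepD:
  "left_indep \<phi> m \<Longrightarrow> finite S \<Longrightarrow> (\<Sum>i\<in>S. \<phi> (c i) * m i) = 0 \<Longrightarrow> i \<in> S \<Longrightarrow> c i = 0"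
  unfolding left_indep_def by blast

lemma left_indep_inj:
  assumes "unital_hom \<phi>" and "left_indep \<phi> m"
  shows "inj \<phi>"
proof (rule injI)
  fix a b assume "\<phi> a = \<phi> b"
  then have "\<phi> (a - b) = 0" by (simp add: unital_hom.diff[OF assms(1)])
  then show "a = b"
    using left_indepD[OF assms(2), of "{undefined}" "\<lambda>_. a - b"] by simp
qed

text \<open>Coefficients stand to the left of the powers of \<open>t\<close>. If \<open>t\<close>
  commutes with them, this is a ring homomorphism; for the skew variable \<open>Y\<close> below,
  only the rules for \<open>pCons\<close>, sums and left scalars are used.\<close>

definition poly_eval_hom :: "('a::comm_ring_1 \<Rightarrow> 'd::ring_1) \<Rightarrow> 'd \<Rightarrow> 'a poly \<Rightarrow> 'd" where
  "poly_eval_hom \<phi> t p = (\<Sum>i\<le>degree p. \<phi> (coeff p i) * t ^ i)"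

lemma poly_eval_hom_bound:
  assumes "unital_hom \<phi>" "degree p \<le> n"
  shows "poly_eval_hom \<phi> t p = (\<Sum>i\<le>n. \<phi> (coeff p i) * t ^ i)"
  unfolding poly_eval_hom_def using assms
  by (intro sum.mono_neutral_left) (auto simp: coeff_eq_0 unital_hom.zero)

lemma poly_eval_hom_pCons:
  assumes "unital_hom \<phi>"
  shows "poly_eval_hom \<phi> t (pCons a p) = \<phi> a + poly_eval_hom \<phi> t p * t"
proof -
  have "poly_eval_hom \<phi> t (pCons a p) = (\<Sum>i\<le>Suc (degree p). \<phi> (coeff (pCons a p) i) * t ^ i)"
    by (rule poly_eval_hom_bound) (simp_all add: assms degree_pCons_le)
  also have "\<dots> = \<phi> a + (\<Sum>i\<le>degree p. \<phi> (coeff p i) * t ^ Suc i)"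
    by (subst sum.atMost_Suc_shift) simp
  also have "\<dots> = \<phi> a + poly_eval_hom \<phi> t p * t"
    by (simp add: poly_eval_hom_def sum_distrib_right mult.assoc power_Suc2 del: power_Suc)
  finally show ?thesis .
qed

lemma poly_eval_hom_0: "unital_hom \<phi> \<Longrightarrow> poly_eval_hom \<phi> t 0 = 0"
  by (simp add: poly_eval_hom_def unital_hom.zero)

lemma poly_eval_hom_add:
  assumes "unital_hom \<phi>"
  shows "poly_eval_hom \<phi> t (p + q) = poly_eval_hom \<phi> t p + poly_eval_hom \<phi> t q"
  by (induction p q rule: poly_induct2)
     (simp_all add: poly_eval_hom_0 poly_eval_hom_pCons unital_hom.add distrib_right ac_simps assms)

lemma poly_eval_hom_smult:
  assumes "unital_hom \<phi>"
  shows "poly_eval_hom \<phi> t (smult a p) = \<phi> a * poly_eval_hom \<phi> t p"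
proof -
  interpret unital_hom \<phi> by fact
  have "\<phi> a * \<phi> b = \<phi> b * \<phi> a" for a b
    using mult[of a b] mult[of b a] by (simp add: mult.commute)
  then show ?thesis
    by (induction p)
       (simp_all add: poly_eval_hom_0 poly_eval_hom_pCons mult distrib_left mult.assoc assms)
qed

lemma unital_hom_poly_eval_hom:
  assumes "unital_hom \<phi>" and comm: "\<And>a. \<phi> a * t = t * \<phi> a"
  shows "unital_hom (poly_eval_hom \<phi> t)"
proof -
  interpret unital_hom \<phi> by fact
  note pc = poly_eval_hom_pCons[OF assms(1)]
  note p0 = poly_eval_hom_0[OF assms(1)]
  note padd = poly_eval_hom_add[OF assms(1)] and psm = poly_eval_hom_smult[OF assms(1)]
  have pcomm: "poly_eval_hom \<phi> t p * t = t * poly_eval_hom \<phi> t p" for p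
    by (induction p) (simp_all add: p0 pc comm distrib_left distrib_right mult.assoc)
  show ?thesis
  proof
    show "poly_eval_hom \<phi> t 1 = 1" by (simp add: poly_eval_hom_def one)
    fix p q
    show "poly_eval_hom \<phi> t (p + q) = poly_eval_hom \<phi> t p + poly_eval_hom \<phi> t q" by (rule padd)
    show "poly_eval_hom \<phi> t (p * q) = poly_eval_hom \<phi> t p * poly_eval_hom \<phi> t q"
    proof (induction p)
      case (pCons a p)
      have "poly_eval_hom \<phi> t (pCons a p * q) =
        \<phi> a * poly_eval_hom \<phi> t q + poly_eval_hom \<phi> t (p * q) * t"
        by (simp add: padd psm pc zero)
      also have "\<dots> = (\<phi> a + poly_eval_hom \<phi> t p * t) * poly_eval_hom \<phi> t q"
        by (simp only: pCons.IH distrib_right mult.assoc pcomm[of q])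
      finally show ?case by (simp add: pc)
    qed (simp add: p0)
  qed
qed

text \<open>Expanding every polynomial coefficient up to a common degree \<open>n\<close> turns a
  relation over the polynomial ring into one between the products \<open>t ^ j * m i\<close> over
  the image of \<open>\<phi>\<close>.\<close>

lemma left_indep_poly_eval_hom:
  assumes "unital_hom \<phi>" and ind: "left_indep \<phi> (\<lambda>(j, i). t ^ j * m i)"
  shows "left_indep (poly_eval_hom \<phi> t) m"
  unfolding left_indep_def
proof (intro allI impI ballI)
  fix S and c :: "'c \<Rightarrow> 'a poly" and i
  assume S: "finite S" and i: "i \<in> S"
    and eq: "(\<Sum>i\<in>S. poly_eval_hom \<phi> t (c i) * m i) = 0"
  define n where "n = Max ((\<lambda>i. degree (c i)) ` S)"
  have n: "degree (c i) \<le> n" if "i \<in> S" for i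
    unfolding n_def using S that by (intro Max_ge) auto
  have "(\<Sum>i\<in>S. poly_eval_hom \<phi> t (c i) * m i) =
      (\<Sum>i\<in>S. \<Sum>j\<le>n. \<phi> (coeff (c i) j) * (t ^ j * m i))"
    by (intro sum.cong) (simp_all add: poly_eval_hom_bound[OF assms(1) n] sum_distrib_right mult.assoc)
  also have "\<dots> = (\<Sum>x\<in>{..n} \<times> S. \<phi> (coeff (c (snd x)) (fst x)) * (case x of (j, i) \<Rightarrow> t ^ j * m i))"
    by (subst sum.swap) (simp add: sum.cartesian_product case_prod_unfold)
  finally have *: "coeff (c i) j = 0" if "j \<le> n" for j
    using left_indepD[OF ind, of "{..n} \<times> S" "\<lambda>x. coeff (c (snd x)) (fst x)" "(j, i)"] S i that eq
    by auto
  have "coeff (c i) j = 0" for j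
    using *[of j] n[OF i] by (cases "j \<le> n") (auto intro: coeff_eq_0)
  then show "c i = 0" by (simp add: poly_eqI)
qed

section \<open>Extension of injective homomorphisms to fraction fields\<close>

definition lift_fract :: "('a::idom \<Rightarrow> 'd::division_ring) \<Rightarrow> 'a fract \<Rightarrow> 'd" where
  "lift_fract \<phi> x =
     (let r = (SOME r. snd r \<noteq> 0 \<and> x = Fract (fst r) (snd r)) in \<phi> (fst r) * inverse (\<phi> (snd r)))"

locale inj_hom = unital_hom \<phi> for \<phi> :: "'a::idom \<Rightarrow> 'd::division_ring" +
  assumes inj: "inj \<phi>"
begin

lemma eq_0_iff: "\<phi> a = 0 \<longleftrightarrow> a = 0"
  by (metis inj injD zero)

lemma commute: "\<phi> a * \<phi> b = \<phi> b * \<phi> a"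
  using mult[of a b] mult[of b a] by (simp add: mult.commute)

lemma commute_inv: "\<phi> a * inverse (\<phi> b) = inverse (\<phi> b) * \<phi> a"
  by (rule commute_inverse) (rule commute)

text \<open>\<open>lift_fract\<close> picks numerator and denominator by choice;
  cross-multiplication and commutativity of the image of \<open>\<phi>\<close> show that every other
  pair gives the same value.\<close>

lemma lift_fract_Fract:
  assumes "b \<noteq> 0"
  shows "lift_fract \<phi> (Fract a b) = \<phi> a * inverse (\<phi> b)"
proof -
  define r where "r = (SOME r. snd r \<noteq> 0 \<and> Fract a b = Fract (fst r) (snd r))"
  have "snd r \<noteq> 0 \<and> Fract a b = Fract (fst r) (snd r)"
    unfolding r_def by (rule someI[of _ "(a, b)"]) (simp add: assms)
  then have nz: "snd r \<noteq> 0" and "a * snd r = fst r * b"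
    using assms by (auto simp: eq_fract)
  then have "\<phi> (a * snd r) = \<phi> (b * fst r)" by (simp add: mult.commute)
  then have "\<phi> a * \<phi> (snd r) = \<phi> b * \<phi> (fst r)" by (simp only: mult)
  moreover have nz': "\<phi> b \<noteq> 0" "\<phi> (snd r) \<noteq> 0" using assms nz by (simp_all add: eq_0_iff)
  ultimately have "\<phi> a = \<phi> b * \<phi> (fst r) * inverse (\<phi> (snd r))"
    by (simp add: nonzero_eq_divide_eq flip: divide_inverse)
  then have "inverse (\<phi> b) * \<phi> a = \<phi> (fst r) * inverse (\<phi> (snd r))"
    using nz' by (simp add: mult.assoc[symmetric])
  then show ?thesis by (simp add: lift_fract_def r_def[symmetric] commute_inv)
qed

lemma lift_fract_to_fract: "lift_fract \<phi> (to_fract a) = \<phi> a"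
  by (simp add: to_fract_def lift_fract_Fract one)

lemma unital_hom_lift_fract: "unital_hom (lift_fract \<phi>)"
proof
  show "lift_fract \<phi> 1 = 1" using lift_fract_to_fract[of 1] by (simp add: one)
  fix x y :: "'a fract"
  obtain a b where x: "x = Fract a b" "b \<noteq> 0" by (cases x)
  obtain c d where y: "y = Fract c d" "d \<noteq> 0" by (cases y)
  have nz: "\<phi> b \<noteq> 0" "\<phi> d \<noteq> 0" using x y by (simp_all add: eq_0_iff)
  have inv: "inverse (\<phi> (b * d)) = inverse (\<phi> b) * inverse (\<phi> d)"
    using commute[of b d] by (simp add: mult nonzero_inverse_mult_distrib nz)
  have swap: "inverse (\<phi> b) * inverse (\<phi> d) = inverse (\<phi> d) * inverse (\<phi> b)"
    using nonzero_inverse_mult_distrib[OF nz] nonzero_inverse_mult_distrib[OF nz(2) nz(1)]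
      commute[of b d] by simp
  have "lift_fract \<phi> (x + y) = \<phi> (a * d + c * b) * inverse (\<phi> (b * d))"
    using x y by (simp add: lift_fract_Fract)
  also have "\<dots> = \<phi> a * \<phi> d * (inverse (\<phi> d) * inverse (\<phi> b)) +
      \<phi> c * \<phi> b * (inverse (\<phi> b) * inverse (\<phi> d))"
    by (simp add: inv[unfolded mult] add mult distrib_right swap)
  also have "\<dots> = \<phi> a * (\<phi> d * inverse (\<phi> d)) * inverse (\<phi> b) +
      \<phi> c * (\<phi> b * inverse (\<phi> b)) * inverse (\<phi> d)"
    by (simp add: mult.assoc)
  finally show "lift_fract \<phi> (x + y) = lift_fract \<phi> x + lift_fract \<phi> y"
    using x y nz by (simp add: lift_fract_Fract)
  have "lift_fract \<phi> (x * y) = \<phi> (a * c) * inverse (\<phi> (b * d))"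
    using x y by (simp add: lift_fract_Fract)
  also have "\<dots> = \<phi> a * (\<phi> c * inverse (\<phi> b)) * inverse (\<phi> d)"
    by (simp add: inv[unfolded mult] mult mult.assoc)
  also have "\<dots> = \<phi> a * inverse (\<phi> b) * (\<phi> c * inverse (\<phi> d))"
    by (simp only: commute_inv[of c b] mult.assoc)
  finally show "lift_fract \<phi> (x * y) = lift_fract \<phi> x * lift_fract \<phi> y"
    using x y by (simp add: lift_fract_Fract)
qed

text \<open>A common denominator of the finitely many coefficients can be pulled out to the left,
  because the image of \<open>\<phi>\<close> is commutative.\<close>

lemma left_indep_lift_fract:
  assumes ind: "left_indep \<phi> m"
  shows "left_indep (lift_fract \<phi>) m"
  unfolding left_indep_def
proof (intro allI impI)
  fix S and c :: "'b \<Rightarrow> 'a fract"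
  assume S: "finite S" and eq: "(\<Sum>i\<in>S. lift_fract \<phi> (c i) * m i) = 0"
  have "\<exists>a b. b \<noteq> 0 \<and> (\<forall>i\<in>S. c i = Fract (a i) b)"
    using S
  proof (induction S)
    case empty
    then show ?case by (rule_tac exI, rule_tac x=1 in exI) simp
  next
    case (insert j S)
    then obtain a b where ab: "b \<noteq> 0" "\<forall>i\<in>S. c i = Fract (a i) b" by blast
    obtain e d where ed: "c j = Fract e d" "d \<noteq> 0" by (cases "c j")
    show ?case
      by (rule exI[of _ "\<lambda>i. if i = j then e * b else a i * d"], rule exI[of _ "b * d"])
         (use ab ed insert.hyps in \<open>auto simp: eq_fract\<close>)
  qed
  then obtain a b where b: "b \<noteq> 0" and ab: "\<And>i. i \<in> S \<Longrightarrow> c i = Fract (a i) b" by blast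
  have "(\<Sum>i\<in>S. lift_fract \<phi> (c i) * m i) = inverse (\<phi> b) * (\<Sum>i\<in>S. \<phi> (a i) * m i)"
    unfolding sum_distrib_left
    by (intro sum.cong) (simp_all add: ab b lift_fract_Fract commute_inv mult.assoc)
  with eq b have "(\<Sum>i\<in>S. \<phi> (a i) * m i) = 0" by (simp add: eq_0_iff)
  then show "\<forall>i\<in>S. c i = 0"
    using left_indepD[OF ind S, of a] ab b by (simp add: fract_collapse)
qed

end


section \<open>The automorphism \<open>x \<mapsto> q x\<close> of \<open>K(x)\<close>\<close>

definition sigma :: "'a::field \<Rightarrow> 'a poly fract \<Rightarrow> 'a poly fract" where
  "sigma q = lift_fract (\<lambda>p. to_fract (pcompose p [:0, q:]))"

lemma pcompose_scale_eq_0_iff: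
  fixes p :: "'a::field poly"
  assumes "q \<noteq> 0"
  shows "pcompose p [:0, q:] = 0 \<longleftrightarrow> p = 0"
proof
  assume "pcompose p [:0, q:] = 0"
  then have "pcompose (pcompose p [:0, q:]) [:0, inverse q:] = 0" by simp
  then show "p = 0"
    using assms by (simp add: pcompose_assoc[symmetric] pcompose_pCons)
qed simp

lemma inj_hom_sigma:
  fixes q :: "'a::field"
  assumes "q \<noteq> 0"
  shows "inj_hom (\<lambda>p. to_fract (pcompose p [:0, q:]))"
proof
  show "inj (\<lambda>p. to_fract (pcompose p [:0, q:]))"
  proof (rule injI)
    fix p r :: "'a poly"
    assume "to_fract (pcompose p [:0, q:]) = to_fract (pcompose r [:0, q:])"
    then have "pcompose (p - r) [:0, q:] = 0" by (simp add: pcompose_diff)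
    then show "p = r" using assms by (simp add: pcompose_scale_eq_0_iff)
  qed
qed (simp_all add: pcompose_add pcompose_mult pcompose_1)

lemma unital_hom_sigma: "q \<noteq> 0 \<Longrightarrow> unital_hom (sigma q)"
  unfolding sigma_def by (rule inj_hom.unital_hom_lift_fract) (rule inj_hom_sigma)

lemma sigma_Fract:
  assumes "q \<noteq> 0" "s \<noteq> 0"
  shows "sigma q (Fract r s) = Fract (pcompose r [:0, q:]) (pcompose s [:0, q:])"
  unfolding sigma_def
  by (subst inj_hom.lift_fract_Fract[OF inj_hom_sigma])
     (use assms in \<open>simp_all add: to_fract_def\<close>)

lemma sigma_inverse_sigma:
  assumes "q \<noteq> 0"
  shows "sigma (inverse q) (sigma q f) = f"
proof (cases f)
  case (Fract r s)
  then show ?thesis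
    using assms by (simp add: sigma_Fract pcompose_scale_eq_0_iff pcompose_assoc[symmetric] pcompose_pCons)
qed

text \<open>With \<open>g = P / Q\<close>, the equation \<open>sigma q g = g + 1\<close> becomes
  \<open>P' * Q = (P + Q) * Q'\<close>, where primes denote the substitution. Degrees clash if
  \<open>degree P < degree Q\<close>, leading coefficients clash if the degrees agree, and otherwise
  \<open>q ^ (degree P - degree Q) = 1\<close>.\<close>

lemma sigma_no_unit_difference:
  fixes q :: "'a::field"
  assumes q: "q \<noteq> 0" "\<And>n. n > 0 \<Longrightarrow> q ^ n \<noteq> 1"
  shows "sigma q g - g \<noteq> 1"
proof
  assume "sigma q g - g = 1"
  then have g: "sigma q g = g + 1" by (simp add: algebra_simps)
  obtain P Q where PQ: "g = Fract P Q" "Q \<noteq> 0" by (cases g)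
  define P' where "P' = pcompose P [:0, q:]"
  define Q' where "Q' = pcompose Q [:0, q:]"
  have deg: "degree P' = degree P" "degree Q' = degree Q"
    using q by (simp_all add: P'_def Q'_def degree_pcompose)
  have lead: "lead_coeff P' = lead_coeff P * q ^ degree P" "lead_coeff Q' = lead_coeff Q * q ^ degree Q"
    using q by (simp_all add: P'_def Q'_def lead_coeff_comp)
  have nz: "Q' \<noteq> 0" using q PQ by (simp add: Q'_def pcompose_scale_eq_0_iff)
  have "Fract P' Q' = Fract (P + Q) Q"
    using g PQ q by (simp add: sigma_Fract P'_def Q'_def One_fract_def)
  then have eq: "P' * Q = (P + Q) * Q'"
    using nz PQ by (simp add: eq_fract)
  consider "degree P < degree Q" | "degree P = degree Q" | "degree P > degree Q" by linarith
  then show False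
  proof cases
    case 1
    then have d: "degree (P + Q) = degree Q" by (rule degree_add_eq_right)
    have "P + Q \<noteq> 0" using 1 d by auto
    then have "degree ((P + Q) * Q') = degree Q + degree Q"
      using nz d deg by (simp add: degree_mult_eq)
    moreover have "degree (P' * Q) \<le> degree P + degree Q"
      using degree_mult_le[of P' Q] deg by simp
    ultimately show False using 1 eq by simp
  next
    case 2
    have "coeff (P' * Q) (degree P + degree Q) = lead_coeff P * q ^ degree P * lead_coeff Q"
      using coeff_mult_degree_sum[of P' Q] deg lead by simp
    moreover have "coeff ((P + Q) * Q') (degree P + degree Q) =
       lead_coeff P * (lead_coeff Q * q ^ degree Q) + lead_coeff Q * (lead_coeff Q * q ^ degree Q)"
      using coeff_mult_degree_sum[of P Q'] coeff_mult_degree_sum[of Q Q'] deg lead 2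
      by (simp add: distrib_right)
    ultimately have "lead_coeff Q * (lead_coeff Q * q ^ degree Q) = 0"
      using eq 2 by simp
    then show False using PQ q by simp
  next
    case 3
    then have d: "degree (P + Q) = degree P" and l: "coeff (P + Q) (degree P) = lead_coeff P"
      by (simp_all add: degree_add_eq_left coeff_eq_0)
    have "coeff (P' * Q) (degree P + degree Q) = lead_coeff P * q ^ degree P * lead_coeff Q"
      using coeff_mult_degree_sum[of P' Q] deg lead by simp
    moreover have "coeff ((P + Q) * Q') (degree P + degree Q) =
       lead_coeff P * (lead_coeff Q * q ^ degree Q)"
      using coeff_mult_degree_sum[of "P + Q" Q'] deg lead d l by simp
    ultimately have "lead_coeff P * lead_coeff Q * q ^ degree P =
        lead_coeff P * lead_coeff Q * q ^ degree Q"
      using eq by (simp add: mult_ac)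
    moreover have "P \<noteq> 0" using 3 by auto
    ultimately have "q ^ degree P = q ^ degree Q" using PQ by simp
    moreover have "q ^ degree P = q ^ (degree P - degree Q) * q ^ degree Q"
      using 3 by (simp flip: power_add)
    ultimately have "q ^ (degree P - degree Q) = 1" using q by simp
    then show False using q(2)[of "degree P - degree Q"] 3 by simp
  qed
qed

section \<open>Poles of rational functions\<close>

definition regular_at :: "'a::field \<Rightarrow> 'a poly fract \<Rightarrow> bool" where
  "regular_at a f \<longleftrightarrow> (\<exists>P Q. poly Q a \<noteq> 0 \<and> f = Fract P Q)"

lemma regular_at_to_fract: "regular_at a (to_fract p)"
  unfolding regular_at_def to_fract_def by (metis poly_1 zero_neq_one)

lemma regular_at_add:
  assumes "regular_at a f" "regular_at a g"
  shows "regular_at a (f + g)"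
proof -
  obtain P Q R S where "poly Q a \<noteq> 0" "f = Fract P Q" "poly S a \<noteq> 0" "g = Fract R S"
    using assms by (auto simp: regular_at_def)
  moreover from this have "Q \<noteq> 0" "S \<noteq> 0" by auto
  ultimately show ?thesis unfolding regular_at_def
    by (intro exI[of _ "P * S + R * Q"] exI[of _ "Q * S"]) simp
qed

lemma regular_at_mult:
  assumes "regular_at a f" "regular_at a g"
  shows "regular_at a (f * g)"
proof -
  obtain P Q R S where "poly Q a \<noteq> 0" "f = Fract P Q" "poly S a \<noteq> 0" "g = Fract R S"
    using assms by (auto simp: regular_at_def)
  then show ?thesis unfolding regular_at_def
    by (intro exI[of _ "P * R"] exI[of _ "Q * S"]) simp
qed

lemma regular_at_diff:
  assumes "regular_at a f" "regular_at a g"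
  shows "regular_at a (f - g)"
  using regular_at_add[OF assms(1) regular_at_mult[OF regular_at_to_fract[of a "-1"] assms(2)]]
  by simp

lemma regular_at_power: "regular_at a f \<Longrightarrow> regular_at a (f ^ n)"
  using regular_at_to_fract[of a 1] by (induction n) (simp_all add: regular_at_mult)

lemma regular_at_sum: "(\<And>i. i \<in> S \<Longrightarrow> regular_at a (f i)) \<Longrightarrow> regular_at a (sum f S)"
  using regular_at_to_fract[of a 0]
  by (induction S rule: infinite_finite_induct) (simp_all add: regular_at_add)

lemma regular_at_inverse:
  assumes "poly p a \<noteq> 0"
  shows "regular_at a (inverse (to_fract p))"
  using assms unfolding regular_at_def to_fract_def
  by (intro exI[of _ 1] exI[of _ p]) simp

text \<open>Substitution turns a denominator not vanishing at \<open>q * a\<close> into one not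
  vanishing at \<open>a\<close>; the converse undoes it with \<open>inverse q\<close>.\<close>

lemma regular_at_sigma:
  assumes q: "q \<noteq> 0"
  shows "regular_at a (sigma q f) \<longleftrightarrow> regular_at (q * a) f"
proof
  assume "regular_at (q * a) f"
  then obtain P Q where PQ: "poly Q (q * a) \<noteq> 0" "f = Fract P Q" by (auto simp: regular_at_def)
  then have "Q \<noteq> 0" by auto
  with PQ q show "regular_at a (sigma q f)"
    unfolding regular_at_def
    by (intro exI[of _ "pcompose P [:0, q:]"] exI[of _ "pcompose Q [:0, q:]"])
       (simp add: sigma_Fract poly_pcompose mult.commute)
next
  assume "regular_at a (sigma q f)"
  then obtain P Q where PQ: "poly Q a \<noteq> 0" "sigma q f = Fract P Q" by (auto simp: regular_at_def)
  then have Q: "Q \<noteq> 0" by auto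
  have f: "f = Fract (pcompose P [:0, inverse q:]) (pcompose Q [:0, inverse q:])"
    using sigma_inverse_sigma[OF q, of f] PQ q Q by (simp add: sigma_Fract)
  show "regular_at (q * a) f"
    unfolding regular_at_def
    by (rule exI[of _ "pcompose P [:0, inverse q:]"], rule exI[of _ "pcompose Q [:0, inverse q:]"])
       (use PQ q in \<open>simp add: f poly_pcompose mult_ac\<close>)
qed

text \<open>Since \<open>q\<close> has infinite order, the orbit of 1 under scaling consists of
  distinct points \<open>q powi n\<close>, one for each integer.\<close>

locale q_scaling =
  fixes q :: "'a::field"
  assumes q_nz: "q \<noteq> 0" and q_power: "\<And>n. n > 0 \<Longrightarrow> q ^ n \<noteq> 1"
begin

sublocale sigma: unital_hom "sigma q" by (rule unital_hom_sigma) (rule q_nz)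

lemma powi_eq_1_iff: "q powi n = 1 \<longleftrightarrow> n = 0"
proof
  assume eq: "q powi n = 1"
  show "n = 0"
  proof (rule ccontr)
    assume "n \<noteq> 0"
    then have "nat \<bar>n\<bar> > 0" by simp
    moreover have "q ^ nat \<bar>n\<bar> = 1"
      using eq by (auto simp: power_int_def abs_if power_inverse split: if_splits)
    ultimately show False using q_power by blast
  qed
qed simp

lemma inj_powi: "inj (\<lambda>n. q powi n)"
proof (rule injI)
  fix m n assume "q powi m = q powi n"
  then have "q powi (m - n) = 1" using q_nz by (simp add: power_int_diff)
  then show "m = n" by (simp add: powi_eq_1_iff)
qed

text \<open>Poles are zeros of a denominator, and distinct exponents give distinct points.\<close>

lemma finite_not_regular: "finite {n. \<not> regular_at (q powi n) f}"
proof (cases f)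
  case (Fract P Q)
  have "{n. \<not> regular_at (q powi n) f} \<subseteq> (\<lambda>n. q powi n) -` {a. poly Q a = 0}"
    using Fract by (auto simp: regular_at_def)
  moreover have "finite ((\<lambda>n. q powi n) -` {a. poly Q a = 0})"
    by (rule finite_vimageI[OF poly_roots_finite inj_powi]) (use Fract in auto)
  ultimately show ?thesis by (rule finite_subset)
qed

lemma regular_sigma_powi: "regular_at (q powi n) (sigma q f) \<longleftrightarrow> regular_at (q powi (n + 1)) f"
  using q_nz by (simp add: regular_at_sigma power_int_add mult.commute)

text \<open>A pole at one exponent would be passed on to every larger one, contradicting
  \<open>finite_not_regular\<close>.\<close>

lemma regular_upwards:
  assumes step: "\<And>n. n \<ge> N \<Longrightarrow> regular_at (q powi n) f \<longleftrightarrow> regular_at (q powi (n + 1)) f"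
    and "n \<ge> N"
  shows "regular_at (q powi n) f"
proof (rule ccontr)
  assume neg: "\<not> regular_at (q powi n) f"
  have "\<not> regular_at (q powi (n + int j)) f" for j
  proof (induction j)
    case (Suc j)
    then show ?case using step[of "n + int j"] \<open>n \<ge> N\<close> by (simp add: add_ac)
  qed (simp add: neg)
  then have "range (\<lambda>j. n + int j) \<subseteq> {n. \<not> regular_at (q powi n) f}" by auto
  then have "finite (range (\<lambda>j. n + int j))" using finite_not_regular by (rule finite_subset)
  then show False using range_inj_infinite[of "\<lambda>j. n + int j"] by (simp add: inj_def)
qed

lemma regular_downwards:
  assumes step: "\<And>n. n < N \<Longrightarrow> regular_at (q powi n) f \<longleftrightarrow> regular_at (q powi (n + 1)) f"
    and "n \<le> N"
  shows "regular_at (q powi n) f"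
proof (rule ccontr)
  assume neg: "\<not> regular_at (q powi n) f"
  have "\<not> regular_at (q powi (n - int j)) f" for j
  proof (induction j)
    case (Suc j)
    then show ?case using step[of "n - int (Suc j)"] \<open>n \<le> N\<close> by (simp add: algebra_simps)
  qed (simp add: neg)
  then have "range (\<lambda>j. n - int j) \<subseteq> {n. \<not> regular_at (q powi n) f}" by auto
  then have "finite (range (\<lambda>j. n - int j))" using finite_not_regular by (rule finite_subset)
  then show False using range_inj_infinite[of "\<lambda>j. n - int j"] by (simp add: inj_def)
qed

text \<open>Invariance links all neighbouring points of the orbit, so one pole would spread to
  infinitely many.\<close>

lemma regular_fixed:
  assumes "sigma q c = c"
  shows "regular_at (q powi n) c"
proof (rule regular_upwards[of n])
  show "regular_at (q powi j) c \<longleftrightarrow> regular_at (q powi (j + 1)) c" for j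
    using regular_sigma_powi[of j c] unfolding assms .
qed simp

text \<open>
  The orbit of the point 1 is \<open>{q\<^sup>n}\<close>.  A difference \<open>sigma g - g\<close> never has a pole at
  exactly one point of that orbit, because \<open>g\<close> has only finitely many poles.
\<close>

lemma regular_sigma_diff:
  assumes "\<And>n. n \<noteq> 0 \<Longrightarrow> regular_at (q powi n) (sigma q g - g)"
  shows "regular_at 1 (sigma q g - g)"
proof -
  \<comment> \<open>The link between exponents \<open>n\<close> and \<open>n + 1\<close> is missing
    only for \<open>n = 0\<close>, so \<open>g\<close> is treated separately from exponent 1 upwards
    and from exponent 0 downwards.\<close>
  have step: "regular_at (q powi n) g \<longleftrightarrow> regular_at (q powi (n + 1)) g" if "n \<noteq> 0" for n
  proof -
    have "regular_at (q powi n) g \<longleftrightarrow> regular_at (q powi n) (sigma q g)"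
      using regular_at_add[OF assms[OF that], of g] regular_at_diff[OF _ assms[OF that], of "sigma q g"]
      by auto
    then show ?thesis by (simp add: regular_sigma_powi)
  qed
  have "regular_at (q powi 1) g" by (rule regular_upwards[of 1], rule step) simp_all
  then have "regular_at (q powi 0) (sigma q g)" using regular_sigma_powi[of 0 g] by simp
  moreover have "regular_at (q powi 0) g" by (rule regular_downwards[of 0], rule step) simp_all
  ultimately show ?thesis using regular_at_diff by force
qed

section \<open>The element x / (1 - x)^2 and its powers\<close>

definition letter :: "'a poly fract" where
  "letter = (inverse (1 - to_fract [:0, 1:]))\<^sup>2 - inverse (1 - to_fract [:0, 1:])"

text \<open>The definition of \<open>letter\<close> matches the shape of \<open>bump\<close>; this
  form displays the double pole at 1.\<close>

lemma letter_Fract: "letter = to_fract [:0, 1:] * inverse (to_fract ([:1, -1:]\<^sup>2))"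
proof -
  have 1: "1 - to_fract [:0, 1 :: 'a:] = to_fract [:1, -1:]"
    by (simp add: one_pCons flip: to_fract_1 to_fract_diff)
  have nz: "to_fract [:1, -1 :: 'a:] \<noteq> 0" by simp
  have x: "to_fract [:0, 1 :: 'a:] = 1 - to_fract [:1, -1:]" using 1 by (simp add: algebra_simps)
  show ?thesis unfolding letter_def 1 using nz
    unfolding x power2_eq_square to_fract_mult by (simp add: field_simps)
qed

lemma letter_nz: "letter \<noteq> 0"
  by (simp add: letter_Fract)

lemma regular_letter: "n \<noteq> 0 \<Longrightarrow> regular_at (q powi n) letter"
  unfolding letter_Fract
  by (intro regular_at_mult regular_at_to_fract regular_at_inverse) (auto simp: powi_eq_1_iff)

lemma regular_inverse_letter: "regular_at 1 (inverse letter)"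
  unfolding letter_Fract inverse_mult_distrib inverse_inverse_eq
  by (intro regular_at_mult regular_at_to_fract regular_at_inverse) auto

lemma not_regular_letter: "\<not> regular_at 1 letter"
proof
  assume "regular_at 1 letter"
  then obtain P Q where PQ: "poly Q 1 \<noteq> 0" "letter = Fract P Q" by (auto simp: regular_at_def)
  have "letter = Fract [:0, 1:] ([:1, -1:]\<^sup>2)"
    unfolding letter_Fract by (simp add: to_fract_def)
  with PQ have "Fract [:0, 1:] ([:1, -1:]\<^sup>2) = Fract P Q" by simp
  moreover have "Q \<noteq> 0" using PQ by auto
  ultimately have "[:0, 1:] * Q = P * [:1, -1:]\<^sup>2"
    by (subst (asm) eq_fract) auto
  then have "poly ([:0, 1:] * Q) 1 = poly (P * [:1, -1:]\<^sup>2) 1" by simp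
  then show False using PQ by simp
qed

text \<open>Dividing by the top coefficient, which is fixed by \<open>sigma q\<close>, keeps the
  right-hand side a difference. If the top exponent is 0, that difference would be 1. Otherwise
  \<open>regular_sigma_diff\<close> removes the pole at 1 from the sum, although its top term has
  one of strictly largest order.\<close>

lemma letter_powers_indep:
  assumes T: "finite T" and fixed: "\<And>i. i \<in> T \<Longrightarrow> sigma q (c i) = c i"
    and eq: "(\<Sum>i\<in>T. c i * letter ^ i) = sigma q g - g"
  shows "\<forall>i\<in>T. c i = 0"
proof (rule ccontr)
  assume "\<not> (\<forall>i\<in>T. c i = 0)"
  define T' where "T' = {i\<in>T. c i \<noteq> 0}"
  define m where "m = Max T'"
  have T': "finite T'" "T' \<noteq> {}" using T \<open>\<not> (\<forall>i\<in>T. c i = 0)\<close> by (auto simp: T'_def)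
  then have m: "m \<in> T'" and max: "\<And>i. i \<in> T' \<Longrightarrow> i \<le> m" by (auto simp: m_def)
  define d where "d = (\<lambda>i. c i * inverse (c m))"
  define h where "h = (\<Sum>i\<in>T'. d i * letter ^ i)"
  have dm: "d m = 1" using m by (simp add: d_def T'_def)
  have cm: "sigma q (inverse (c m)) = inverse (c m)"
    using m fixed by (simp add: unital_hom_inverse[OF sigma.unital_hom_axioms] T'_def)
  have df: "sigma q (d i) = d i" if "i \<in> T'" for i
    using that fixed by (simp add: d_def sigma.mult cm T'_def)
  have "h = (\<Sum>i\<in>T. c i * letter ^ i) * inverse (c m)"
    unfolding h_def sum_distrib_right T'_def
    by (rule sum.mono_neutral_cong_left) (auto simp: T d_def mult_ac)
  then have h: "h = sigma q (g * inverse (c m)) - g * inverse (c m)"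
    unfolding eq by (simp add: sigma.mult cm algebra_simps)
  show False
  proof (cases "m = 0")
    case True
    then have "T' = {0}" using m max by auto
    then have "h = 1" using dm True by (simp add: h_def)
    then show False using h sigma_no_unit_difference[OF q_nz q_power, of "g * inverse (c m)"] by simp
  next
    case False
    have "regular_at (q powi n) h" if "n \<noteq> 0" for n
      unfolding h_def using that df
      by (intro regular_at_sum regular_at_mult regular_at_power regular_letter regular_fixed) auto
    then have reg: "regular_at 1 h" unfolding h by (rule regular_sigma_diff)
    \<comment> \<open>Dividing by this power leaves \<open>letter\<close> itself as the top term,
      while every other term becomes regular at 1.\<close>
    have "h * inverse letter ^ (m - 1) = (\<Sum>i\<in>T'. d i * (letter ^ i * inverse letter ^ (m - 1)))"
      by (simp add: h_def sum_distrib_right mult.assoc)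
    also have "\<dots> = d m * (letter ^ m * inverse letter ^ (m - 1)) +
        (\<Sum>i\<in>T' - {m}. d i * (letter ^ i * inverse letter ^ (m - 1)))"
      using T' m by (simp add: sum.remove)
    also have "letter ^ m * inverse letter ^ (m - 1) = letter"
      using False letter_nz by (cases m) (simp_all add: power_inverse)
    also have "(\<Sum>i\<in>T' - {m}. d i * (letter ^ i * inverse letter ^ (m - 1))) =
        (\<Sum>i\<in>T' - {m}. d i * inverse letter ^ (m - 1 - i))"
    proof (rule sum.cong[OF HOL.refl], rule arg_cong2[where f = "(*)", OF HOL.refl])
      fix i assume "i \<in> T' - {m}"
      then have "i \<le> m - 1" using max[of i] by auto
      then have "inverse letter ^ (m - 1) = inverse letter ^ i * inverse letter ^ (m - 1 - i)"
        using power_add[of "inverse letter" i "m - 1 - i"] by (simp only: le_add_diff_inverse)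
      then show "letter ^ i * inverse letter ^ (m - 1) = inverse letter ^ (m - 1 - i)"
        using letter_nz by (simp add: power_inverse)
    qed
    finally have "letter = h * inverse letter ^ (m - 1) -
        (\<Sum>i\<in>T' - {m}. d i * inverse letter ^ (m - 1 - i))"
      by (simp add: dm)
    moreover have "regular_at 1 (d i)" if "i \<in> T'" for i
      using regular_fixed[OF df[OF that], of 0] by simp
    then have "regular_at 1 (h * inverse letter ^ (m - 1) -
        (\<Sum>i\<in>T' - {m}. d i * inverse letter ^ (m - 1 - i)))"
      by (intro regular_at_diff regular_at_mult regular_at_power regular_at_sum reg regular_inverse_letter)
         auto
    ultimately show False using not_regular_letter by simp
  qed
qed

end


section \<open>Independence of words over a skew polynomial ring\<close>

text \<open>\<open>\<Psi>\<close> places the field F inside the division ring, \<open>Y\<close>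
  plays the part of y and \<open>a\<close> that of u. All that is kept of the pole argument is
  \<open>letters_indep\<close>; \<open>powers_indep\<close> makes \<open>R\<close> a faithful copy
  of the skew polynomial ring.\<close>

locale skew_words =
  fixes \<Psi> :: "'f::field \<Rightarrow> 'd::division_ring" and \<sigma> :: "'f \<Rightarrow> 'f" and Y :: 'd and a :: 'f
  assumes hom: "unital_hom \<Psi>" and hom_\<sigma>: "unital_hom \<sigma>"
    and skew: "Y * \<Psi> f = \<Psi> (\<sigma> f) * Y"
    and powers_indep: "left_indep \<Psi> (\<lambda>l. Y ^ l)"
    and letters_indep:
      "finite T \<Longrightarrow> (\<And>i. i \<in> T \<Longrightarrow> \<sigma> (c i) = c i) \<Longrightarrow>
        (\<Sum>i\<in>T. c i * a ^ i) = \<sigma> g - g \<Longrightarrow> \<forall>i\<in>T. c i = 0"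
begin

sublocale \<Psi>: unital_hom \<Psi> by (rule hom)
sublocale \<sigma>: unital_hom \<sigma> by (rule hom_\<sigma>)

definition R :: "'d set" where "R = range (poly_eval_hom \<Psi> Y)"

lemma eval_eq_0: "poly_eval_hom \<Psi> Y p = 0 \<Longrightarrow> p = 0"
  using left_indepD[OF powers_indep, of "{..degree p}" "coeff p" "degree p"]
  by (simp add: poly_eval_hom_def)

lemma eval_const: "poly_eval_hom \<Psi> Y [:f:] = \<Psi> f"
  by (simp add: poly_eval_hom_def)

lemma \<Psi>_in_R: "\<Psi> f \<in> R"
  unfolding R_def using eval_const[of f] by (intro range_eqI[of _ _ "[:f:]"]) simp

lemma R_add:
  assumes "x \<in> R" "y \<in> R"
  shows "x + y \<in> R"
proof -
  obtain p r where "x = poly_eval_hom \<Psi> Y p" "y = poly_eval_hom \<Psi> Y r"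
    using assms by (auto simp: R_def)
  then have "x + y = poly_eval_hom \<Psi> Y (p + r)" by (simp add: poly_eval_hom_add hom)
  then show ?thesis by (simp add: R_def)
qed

lemma R_left_mult:
  assumes "x \<in> R"
  shows "\<Psi> f * x \<in> R"
proof -
  obtain p where "x = poly_eval_hom \<Psi> Y p" using assms by (auto simp: R_def)
  then have "\<Psi> f * x = poly_eval_hom \<Psi> Y (smult f p)" by (simp add: poly_eval_hom_smult hom)
  then show ?thesis by (simp add: R_def)
qed

lemma R_diff:
  assumes "x \<in> R" "y \<in> R"
  shows "x - y \<in> R"
  using R_add[OF assms(1) R_left_mult[OF assms(2), of "- 1"]]
  by (simp add: \<Psi>.uminus \<Psi>.one)

text \<open>Moving \<open>Y\<close> to the right across the coefficients applies
  \<open>\<sigma>\<close> to each of them and raises every exponent by one.\<close>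

lemma R_Y_mult:
  assumes "x \<in> R"
  shows "Y * x \<in> R"
proof -
  obtain p where "x = poly_eval_hom \<Psi> Y p" using assms by (auto simp: R_def)
  moreover have "Y * poly_eval_hom \<Psi> Y p = poly_eval_hom \<Psi> Y (pCons 0 (map_poly \<sigma> p))"
    by (induction p)
       (simp_all add: poly_eval_hom_0 poly_eval_hom_pCons hom \<Psi>.zero \<sigma>.zero map_poly_pCons
         distrib_left distrib_right skew mult.assoc[symmetric])
  ultimately show ?thesis by (simp add: R_def)
qed

section \<open>The inverse of 1 - Y and words in it\<close>

definition B :: 'd where "B = inverse (1 - Y)"

lemma Y_neq_1: "1 - Y \<noteq> 0"
proof
  assume "1 - Y = 0"
  then have "poly_eval_hom \<Psi> Y [:1, -1:] = 0"
    by (simp add: poly_eval_hom_pCons hom poly_eval_hom_0 \<Psi>.one \<Psi>.uminus)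
  then show False using eval_eq_0 by force
qed

lemma Y_mult_B: "Y * B = B - 1"
  using right_inverse[OF Y_neq_1] by (simp add: B_def algebra_simps)

text \<open>Multiplying by \<open>1 - Y\<close> on the right twists no coefficients, so it is the
  ordinary product with \<open>[:1, -1:]\<close>. That product has positive degree unless
  \<open>p = 0\<close>, but here it is the constant \<open>f\<close>.\<close>

lemma B_not_in_R:
  assumes "\<Psi> f * B \<in> R"
  shows "f = 0"
proof -
  obtain p where p: "\<Psi> f * B = poly_eval_hom \<Psi> Y p" using assms by (auto simp: R_def)
  have "\<Psi> f = \<Psi> f * B * (1 - Y)" using Y_neq_1 by (simp add: B_def mult.assoc)
  also have "\<dots> = poly_eval_hom \<Psi> Y p + poly_eval_hom \<Psi> Y (smult (- 1) (pCons 0 p))"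
    unfolding p poly_eval_hom_smult[OF hom]
    by (simp add: poly_eval_hom_pCons hom \<Psi>.zero \<Psi>.uminus \<Psi>.one right_diff_distrib)
  finally have "poly_eval_hom \<Psi> Y (p + smult (- 1) (pCons 0 p) + smult (- 1) [:f:]) = 0"
    unfolding poly_eval_hom_add[OF hom] poly_eval_hom_smult[OF hom, of _ _ "[:f:]"] eval_const
    by (simp only: \<Psi>.uminus \<Psi>.one) simp
  then have "p + smult (- 1) (pCons 0 p) + smult (- 1) [:f:] = 0" by (rule eval_eq_0)
  moreover have "p * [:1, -1:] - [:f:] = p + smult (- 1) (pCons 0 p) + smult (- 1) [:f:]"
    by simp
  ultimately have eq: "p * [:1, -1:] = [:f:]" by (simp only: right_minus_eq)
  have "p = 0"
  proof (rule ccontr)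
    assume "p \<noteq> 0"
    then have "degree (p * [:1, -1:]) = degree p + 1" by (subst degree_mult_eq) auto
    then show False using eq by simp
  qed
  then show ?thesis using eq by simp
qed

text \<open>The list \<open>[i, j]\<close> stands for B a^i B a^j B: there is always one more
  \<open>B\<close> than there are exponents.\<close>

fun word :: "nat list \<Rightarrow> 'd" where
  "word [] = B"
| "word (i # w) = B * \<Psi> (a ^ i) * word w"

text \<open>The word without its first \<open>B\<close>; it is what \<open>Y * B = B - 1\<close>
  subtracts.\<close>

fun tail_term :: "nat list \<Rightarrow> 'd" where
  "tail_term [] = 1"
| "tail_term (i # w) = \<Psi> (a ^ i) * word w"

lemma Y_mult_word: "Y * word w = word w - tail_term w"
  by (cases w) (simp_all add: Y_mult_B left_diff_distrib mult.assoc flip: mult.assoc[of Y])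

definition words :: "nat set \<Rightarrow> nat \<Rightarrow> nat list set" where
  "words I n = {w. set w \<subseteq> I \<and> length w \<le> n}"

lemma finite_words: "finite I \<Longrightarrow> finite (words I n)"
  unfolding words_def by (rule finite_lists_length_le)

text \<open>Splitting off the first letter groups the tails of words by the shorter word that
  remains.\<close>

lemma sum_words_Suc:
  assumes "finite I"
  shows "(\<Sum>w\<in>words I (Suc n). G w) = G [] + (\<Sum>w\<in>words I n. \<Sum>i\<in>I. G (i # w))"
proof -
  have "words I (Suc n) = insert [] ((\<lambda>(w, i). i # w) ` (words I n \<times> I))"
  proof (rule set_eqI)
    fix w show "w \<in> words I (Suc n) \<longleftrightarrow> w \<in> insert [] ((\<lambda>(w, i). i # w) ` (words I n \<times> I))"
      by (cases w) (auto simp: words_def image_iff)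
  qed
  moreover have "inj_on (\<lambda>(w, i). i # w) (words I n \<times> I)" by (auto simp: inj_on_def)
  ultimately have "(\<Sum>w\<in>words I (Suc n). G w) = G [] + (\<Sum>(w, i)\<in>words I n \<times> I. G (i # w))"
    using assms by (subst \<open>words I (Suc n) = _\<close>, subst sum.insert)
      (auto simp: finite_words sum.reindex case_prod_unfold)
  then show ?thesis by (simp add: sum.cartesian_product)
qed

text \<open>
  Relations are taken modulo the ring \<open>R = F[Y]\<close>, which absorbs the term 1 of \<open>Y B = B - 1\<close>.
  Normalise a relation so that a word of maximal length has coefficient 1; then
  \<open>Y \<cdot> relation - relation\<close> has fewer words of maximal length, so it vanishes, and comparing its coefficients one length below the maximum contradicts
  the independence of the letters modulo \<open>\<sigma> - 1\<close>.
\<close>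

lemma words_indep:
  assumes I: "finite I"
  shows "(\<Sum>w\<in>words I n. \<Psi> (f w) * word w) \<in> R \<Longrightarrow> w \<in> words I n \<Longrightarrow> f w = 0"
proof (induction n arbitrary: f w)
  case 0
  moreover have "words I 0 = {[]}" by (auto simp: words_def)
  ultimately show ?case using B_not_in_R by simp
next
  case (Suc n)
  \<comment> \<open>The inner induction is on the number of words of maximal length with nonzero
    coefficient; once there are none, the outer induction applies.\<close>
  define top where "top = (\<lambda>f :: nat list \<Rightarrow> 'f. {w. set w \<subseteq> I \<and> length w = Suc n \<and> f w \<noteq> 0})"
  have fin: "finite (top f)" for f
    by (rule finite_subset[OF _ finite_words[OF I, of "Suc n"]]) (auto simp: top_def words_def)
  have sub: "words I n \<subseteq> words I (Suc n)" by (auto simp: words_def)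
  have "\<forall>w\<in>words I (Suc n). f w = 0"
    if "(\<Sum>w\<in>words I (Suc n). \<Psi> (f w) * word w) \<in> R" for f
    using that
  proof (induction "card (top f)" arbitrary: f rule: less_induct)
    case less
    show ?case
    proof (cases "top f = {}")
      case True
      then have z: "f w = 0" if "w \<in> words I (Suc n) - words I n" for w
        using that by (auto simp: top_def words_def)
      then have "(\<Sum>w\<in>words I n. \<Psi> (f w) * word w) = (\<Sum>w\<in>words I (Suc n). \<Psi> (f w) * word w)"
        by (intro sum.mono_neutral_left) (auto simp: finite_words I \<Psi>.zero sub)
      then have "(\<Sum>w\<in>words I n. \<Psi> (f w) * word w) \<in> R" using less.prems by simp
      then have "\<forall>w\<in>words I n. f w = 0" using Suc.IH by blast
      then show ?thesis using z by blast
    next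
      case False
      then obtain w0 where w0: "set w0 \<subseteq> I" "length w0 = Suc n" "f w0 \<noteq> 0"
        by (auto simp: top_def)
      define f1 where "f1 = (\<lambda>w. inverse (f w0) * f w)"
      define S1 where "S1 = (\<Sum>w\<in>words I (Suc n). \<Psi> (f1 w) * word w)"
      \<comment> \<open>The coefficients of \<open>Y * S1 - S1\<close> up to an element of
        \<open>R\<close>. The tail of \<open>i # w\<close> contributes to the coefficient of
        \<open>w\<close>; the length test keeps \<open>i # w\<close> within length
        \<open>Suc n\<close>.\<close>
      define f2 where "f2 = (\<lambda>w. \<sigma> (f1 w) - f1 w -
        (if length w \<le> n then \<Sum>i\<in>I. \<sigma> (f1 (i # w)) * a ^ i else 0))"
      have "S1 = \<Psi> (inverse (f w0)) * (\<Sum>w\<in>words I (Suc n). \<Psi> (f w) * word w)"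
        by (simp add: S1_def f1_def \<Psi>.mult sum_distrib_left mult.assoc)
      then have S1: "S1 \<in> R" using less.prems R_left_mult by simp
      have "Y * S1 = (\<Sum>w\<in>words I (Suc n). \<Psi> (\<sigma> (f1 w)) * (Y * word w))"
        by (simp add: S1_def sum_distrib_left skew flip: mult.assoc)
      also have "\<dots> = (\<Sum>w\<in>words I (Suc n). \<Psi> (\<sigma> (f1 w)) * word w) -
          (\<Sum>w\<in>words I (Suc n). \<Psi> (\<sigma> (f1 w)) * tail_term w)"
        by (simp add: Y_mult_word right_diff_distrib sum_subtractf)
      also have "(\<Sum>w\<in>words I (Suc n). \<Psi> (\<sigma> (f1 w)) * tail_term w) =
          \<Psi> (\<sigma> (f1 [])) + (\<Sum>w\<in>words I n. \<Psi> (\<Sum>i\<in>I. \<sigma> (f1 (i # w)) * a ^ i) * word w)"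
        by (simp add: sum_words_Suc I \<Psi>.sum \<Psi>.mult sum_distrib_right mult.assoc)
      also have "(\<Sum>w\<in>words I n. \<Psi> (\<Sum>i\<in>I. \<sigma> (f1 (i # w)) * a ^ i) * word w) =
        (\<Sum>w\<in>words I (Suc n).
           \<Psi> (if length w \<le> n then \<Sum>i\<in>I. \<sigma> (f1 (i # w)) * a ^ i else 0) * word w)"
        using finite_words[OF I, of "Suc n"]
        by (intro sum.mono_neutral_cong_left) (auto simp: \<Psi>.zero words_def)
      finally have "(\<Sum>w\<in>words I (Suc n). \<Psi> (f2 w) * word w) = Y * S1 - S1 + \<Psi> (\<sigma> (f1 []))"
        by (simp add: f2_def S1_def \<Psi>.diff left_diff_distrib sum_subtractf)
      then have rel: "(\<Sum>w\<in>words I (Suc n). \<Psi> (f2 w) * word w) \<in> R"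
        using R_add R_diff R_Y_mult S1 \<Psi>_in_R by simp
      \<comment> \<open>At \<open>w0\<close> the normalised coefficient is 1, which
        \<open>\<sigma>\<close> fixes, so this word drops out, and no new word of maximal length
        appears.\<close>
      have "top f2 \<subseteq> top f - {w0}"
        using w0 by (auto simp: top_def f2_def f1_def \<sigma>.zero \<sigma>.one)
      moreover have "w0 \<in> top f" using w0 by (simp add: top_def)
      ultimately have "card (top f2) < card (top f)"
        using fin by (intro psubset_card_mono) auto
      then have f2: "f2 w = 0" if "w \<in> words I (Suc n)" for w
        using less.hyps rel that by blast
      \<comment> \<open>At the words \<open>i # u\<close>, vanishing of \<open>f2\<close> says that
        their coefficients are fixed by \<open>\<sigma>\<close>; at \<open>u\<close> it gives the
        equation to which \<open>letters_indep\<close> applies.\<close>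
      obtain j u where ju: "w0 = j # u" using w0 by (cases w0) auto
      have fixed: "\<sigma> (f1 (i # u)) = f1 (i # u)" if "i \<in> I" for i
        using f2[of "i # u"] that w0 ju by (simp add: words_def f2_def)
      have "(\<Sum>i\<in>I. f1 (i # u) * a ^ i) = \<sigma> (f1 u) - f1 u"
        using f2[of u] w0 ju fixed by (simp add: words_def f2_def)
      from letters_indep[OF I fixed this] have "f1 w0 = 0" using w0 ju by simp
      then show ?thesis using w0 by (simp add: f1_def)
    qed
  qed
  then show ?case using Suc.prems by blast
qed

end

text \<open>\<open>\<kappa>\<close> is the inclusion of the base field in F. Its values are fixed by
  \<open>\<sigma>\<close>, hence admissible coefficients in \<open>letters_indep\<close>.\<close>

locale skew_words_algebra = skew_words \<Psi> \<sigma> Y a + k_algebra scale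
  for scale :: "'k::field \<Rightarrow> 'd::division_ring \<Rightarrow> 'd"
    and \<Psi> :: "'f::field \<Rightarrow> 'd" and \<sigma> :: "'f \<Rightarrow> 'f" and Y :: 'd and a :: 'f +
  fixes \<kappa> :: "'k \<Rightarrow> 'f"
  assumes scale_eq: "scale c z = \<Psi> (\<kappa> c) * z"
    and \<kappa>_fixed: "\<sigma> (\<kappa> c) = \<kappa> c"
    and \<kappa>_eq_0: "\<kappa> c = 0 \<Longrightarrow> c = 0"
    and \<kappa>_zero: "\<kappa> 0 = 0"
begin

definition E :: "nat \<times> nat list \<Rightarrow> 'd" where
  "E x = \<Psi> (a ^ fst x) * word (snd x)"

text \<open>Grouping the terms by word gives coefficients in F that vanish by
  \<open>words_indep\<close>. Each is a polynomial in \<open>a\<close> with constant coefficients,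
  and \<open>letters_indep\<close> with \<open>g = 0\<close> shows that these vanish too.\<close>

lemma E_indep:
  assumes S: "finite S" and eq: "(\<Sum>x\<in>S. scale (c x) (E x)) = 0" and "x \<in> S"
  shows "c x = 0"
proof -
  define I where "I = (\<Union>x\<in>S. set (snd x))"
  define n where "n = Max ((\<lambda>x. length (snd x)) ` S)"
  define J where "J = fst ` S"
  define d where "d = (\<lambda>x. if x \<in> S then \<kappa> (c x) else 0)"
  have fin: "finite I" "finite J" using S by (simp_all add: I_def J_def)
  have "length (snd x) \<le> n" if "x \<in> S" for x
    unfolding n_def using S that by (intro Max_ge) auto
  then have sub: "S \<subseteq> J \<times> words I n"
    unfolding J_def words_def I_def mem_Times_iff subset_iff by blast
  have "(\<Sum>x\<in>S. scale (c x) (E x)) = (\<Sum>x\<in>J \<times> words I n. \<Psi> (d x) * E x)"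
  proof (rule sum.mono_neutral_cong_left)
    show "finite (J \<times> words I n)" by (simp add: fin finite_words)
    show "S \<subseteq> J \<times> words I n" by (rule sub)
    show "\<forall>x\<in>J \<times> words I n - S. \<Psi> (d x) * E x = 0" by (simp add: d_def \<Psi>.zero)
    show "scale (c x) (E x) = \<Psi> (d x) * E x" if "x \<in> S" for x
      using that by (simp add: d_def scale_eq[of "c x" "E x"])
  qed
  also have "\<dots> = (\<Sum>i\<in>J. \<Sum>s\<in>words I n. \<Psi> (d (i, s) * a ^ i) * word s)"
    by (simp add: sum.cartesian_product' E_def \<Psi>.mult mult.assoc)
  also have "\<dots> = (\<Sum>s\<in>words I n. \<Psi> (\<Sum>i\<in>J. d (i, s) * a ^ i) * word s)"
    by (subst sum.swap) (simp add: \<Psi>.sum sum_distrib_right)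
  finally have rel: "(\<Sum>s\<in>words I n. \<Psi> (\<Sum>i\<in>J. d (i, s) * a ^ i) * word s) \<in> R"
    using eq \<Psi>_in_R[of 0] by (simp add: \<Psi>.zero)
  obtain i s where x_eq: "x = (i, s)" by (cases x)
  with sub \<open>x \<in> S\<close> have "s \<in> words I n" "i \<in> J" by auto
  have "(\<Sum>i\<in>J. d (i, s) * a ^ i) = 0"
    by (rule words_indep[OF fin(1) rel \<open>s \<in> words I n\<close>])
  then have "(\<Sum>i\<in>J. d (i, s) * a ^ i) = \<sigma> 0 - 0" by (simp add: \<sigma>.zero)
  moreover have "\<sigma> (d (j, s)) = d (j, s)" for j by (simp add: d_def \<kappa>_fixed \<sigma>.zero)
  ultimately have "\<forall>i\<in>J. d (i, s) = 0"
    by (intro letters_indep[OF fin(2), of "\<lambda>i. d (i, s)" 0])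
  then have "d (i, s) = 0" using \<open>i \<in> J\<close> by blast
  then have "\<kappa> (c x) = 0" using x_eq \<open>x \<in> S\<close> by (simp add: d_def)
  then show ?thesis by (rule \<kappa>_eq_0)
qed

lemma inj_E: "inj E"
proof (rule injI, rule ccontr)
  fix x y assume "E x = E y" "x \<noteq> y"
  then have "(\<Sum>z\<in>{x, y}. scale (if z = x then 1 else - 1) (E z)) = 0" by simp
  from E_indep[OF _ this, of x] show False by simp
qed

lemma independent_E: "independent (range E)"
  unfolding independent_explicit_module
proof (intro allI impI)
  fix t u v
  assume t: "finite t" "t \<subseteq> range E" and eq: "(\<Sum>v\<in>t. scale (u v) v) = 0" and v: "v \<in> t"
  define S where "S = E -` t"
  have tS: "t = E ` S" using t by (auto simp: S_def)
  have "finite S" unfolding S_def by (rule finite_vimageI[OF t(1) inj_E])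
  moreover have "(\<Sum>x\<in>S. scale (u (E x)) (E x)) = 0"
    using eq sum.reindex[OF inj_on_subset[OF inj_E subset_UNIV[of S]], of "\<lambda>v. scale (u v) v"]
    unfolding tS by (simp add: o_def)
  ultimately show "u v = 0"
    using E_indep[of S "\<lambda>x. u (E x)"] v tS by blast
qed

section \<open>Leading terms of words in u and v\<close>

definition u :: 'd where "u = \<Psi> a"
definition v :: 'd where "v = B * B - B"

abbreviation pair_word :: "bool list \<Rightarrow> 'd" where
  "pair_word w \<equiv> prod_list (map (\<lambda>b. if b then u else v) w)"

text \<open>The index of the term of \<open>pair_word w * B\<close> with most factors
  \<open>B\<close>, obtained by replacing each \<open>v\<close> by \<open>B * B\<close>. The two
  factors enclose the exponent 0, so each \<open>False\<close> prepends 0 and the previous front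
  exponent to the list.\<close>

fun leading :: "bool list \<Rightarrow> nat \<times> nat list" where
  "leading [] = (0, [])"
| "leading (True # w) = (Suc (fst (leading w)), snd (leading w))"
| "leading (False # w) = (0, 0 # fst (leading w) # snd (leading w))"

text \<open>The first letter can be read off: a positive front exponent means \<open>u\<close>, and
  front exponent 0 with a nonempty list means \<open>v\<close>.\<close>

lemma leading_inj: "leading w = leading w' \<Longrightarrow> w = w'"
proof (induction w arbitrary: w' rule: leading.induct)
  case 1
  then show ?case by (cases w' rule: leading.cases) auto
next
  case (2 w)
  then show ?case by (cases w' rule: leading.cases) (auto simp: prod_eq_iff)
next
  case (3 w)
  then show ?case by (cases w' rule: leading.cases) (auto simp: prod_eq_iff)
qed

definition shorter :: "nat \<Rightarrow> 'd set" where
  "shorter n = span (E ` {x. length (snd x) < n})"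

lemma u_mult_E: "u * E x = E (Suc (fst x), snd x)"
  by (simp add: u_def E_def \<Psi>.mult mult.assoc)

lemma v_mult_E: "v * E x = E (0, 0 # fst x # snd x) - E (0, fst x # snd x)"
  by (simp add: v_def E_def \<Psi>.one left_diff_distrib mult.assoc)

lemma E_shorter: "length (snd x) < n \<Longrightarrow> E x \<in> shorter n"
  unfolding shorter_def by (rule span_base) auto

lemma mult_shorter:
  assumes gen: "\<And>x. length (snd x) < m \<Longrightarrow> z * E x \<in> shorter n" and "y \<in> shorter m"
  shows "z * y \<in> shorter n"
  using assms(2) unfolding shorter_def[of m]
proof (induction rule: span_induct_alt)
  case base
  then show ?case by (simp add: shorter_def span_zero)
next
  case (step c x y)
  then obtain x' where "x = E x'" "length (snd x') < m" by auto
  then have "scale c (z * x) \<in> shorter n" using gen by (simp add: shorter_def span_scale)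
  with step show ?case
    by (simp add: distrib_left shorter_def span_add flip: scale_mult_right)
qed

text \<open>Multiplication by \<open>u\<close> keeps the length of the exponent list. Multiplication
  by \<open>v\<close> lengthens it by two in the leading term and by at most two in the remainder,
  while the \<open>- B\<close> in \<open>v\<close> yields a term one shorter than the new leading
  term.\<close>

lemma pair_word_leading:
  "pair_word w * B - E (leading w) \<in> shorter (length (snd (leading w)))"
proof (induction w rule: leading.induct)
  case 1
  then show ?case by (simp add: E_def \<Psi>.one shorter_def span_zero)
next
  case (2 w)
  have "u * (pair_word w * B - E (leading w)) \<in> shorter (length (snd (leading w)))"
    by (rule mult_shorter[OF _ "2.IH"(1)]) (simp add: u_mult_E E_shorter)
  then show ?case by (simp add: right_diff_distrib u_mult_E mult.assoc)
next
  case (3 w)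
  let ?n = "length (snd (leading (False # w)))"
  have "v * (pair_word w * B - E (leading w)) \<in> shorter ?n"
    by (rule mult_shorter[OF _ "3.IH"(1)]) (simp add: v_mult_E shorter_def span_diff span_base)
  moreover have "E (0, fst (leading w) # snd (leading w)) \<in> shorter ?n"
    by (rule E_shorter) simp
  ultimately have "v * (pair_word w * B - E (leading w)) - E (0, fst (leading w) # snd (leading w))
      \<in> shorter ?n"
    by (simp add: shorter_def span_diff)
  moreover have "v * (pair_word w * B - E (leading w)) - E (0, fst (leading w) # snd (leading w)) =
      pair_word (False # w) * B - E (leading (False # w))"
  proof -
    have "x - (y - z) - z = x - y" for x y z :: 'd by (simp add: algebra_simps)
    then show ?thesis by (simp only: right_diff_distrib v_mult_E leading.simps) (simp add: mult.assoc)
  qed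
  ultimately show ?case by (simp only:)
qed

text \<open>After right multiplication by \<open>B\<close>, take a word with longest leading term.
  Leading terms of distinct words are distinct and all remainders are shorter, so this term occurs
  once and its coefficient must vanish.\<close>

lemma pair_words_indep:
  assumes T: "finite T" and eq: "(\<Sum>w\<in>T. scale (c w) (pair_word w)) = 0"
  shows "\<forall>w\<in>T. c w = 0"
proof (rule ccontr)
  assume "\<not> (\<forall>w\<in>T. c w = 0)"
  define T' where "T' = {w\<in>T. c w \<noteq> 0}"
  have T': "finite T'" "T' \<noteq> {}" using T \<open>\<not> (\<forall>w\<in>T. c w = 0)\<close> by (auto simp: T'_def)
  define len where "len = (\<lambda>w. length (snd (leading w)))"
  define n where "n = Max (len ` T')"
  have "n \<in> len ` T'" unfolding n_def using T' by (intro Max_in) auto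
  then obtain w0 where w0: "w0 \<in> T'" "n = len w0" by auto
  have max: "len w \<le> len w0" if "w \<in> T'" for w
    unfolding w0(2)[symmetric] n_def using T' that by (intro Max_ge) auto
  interpret vector_space_pair scale "(*) :: 'k \<Rightarrow> 'k \<Rightarrow> 'k"
    by unfold_locales (simp_all add: algebra_simps)
  \<comment> \<open>\<open>g\<close> is the coordinate along the chosen leading term: an indicator
    function on the independent family \<open>E\<close>, extended linearly to the whole division
    ring.\<close>
  obtain g where g: "Vector_Spaces.linear scale (*) g"
    and gE: "\<forall>x\<in>range E. g x = (if x = E (leading w0) then 1 else 0)"
    using linear_independent_extend[OF independent_E, of "\<lambda>x. if x = E (leading w0) then 1 else 0"]
    by blast
  interpret g: Vector_Spaces.linear scale "(*)" g by fact
  have gE': "g (E x) = (if x = leading w0 then 1 else 0)" for x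
    using gE[rule_format, OF rangeI, of x] inj_eq[OF inj_E] by simp
  have g_short: "g y = 0" if "y \<in> shorter (len w)" "w \<in> T'" for y w
    using that(1) unfolding shorter_def
  proof (rule linear_eq_0_on_span[OF g, rotated])
    fix x assume "x \<in> E ` {x. length (snd x) < len w}"
    then obtain x' where "x = E x'" "length (snd x') < len w" by blast
    then show "g x = 0" using max[OF that(2)] gE'[of x'] by (auto simp: len_def)
  qed
  have "g (pair_word w * B) = (if w = w0 then 1 else 0)" if "w \<in> T'" for w
  proof -
    have "g (pair_word w * B) = g (pair_word w * B - E (leading w)) + g (E (leading w))"
      by (simp add: g.diff)
    also have "g (pair_word w * B - E (leading w)) = 0"
      using g_short[OF _ that] pair_word_leading by (simp add: len_def)
    finally show ?thesis using leading_inj by (auto simp: gE')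
  qed
  then have "(\<Sum>w\<in>T'. c w * g (pair_word w * B)) = (\<Sum>w\<in>T'. if w = w0 then c w0 else 0)"
    by (intro sum.cong) auto
  also have "\<dots> = c w0" using T' w0 by simp
  also have "(\<Sum>w\<in>T'. c w * g (pair_word w * B)) = g ((\<Sum>w\<in>T'. scale (c w) (pair_word w)) * B)"
    by (simp add: g.sum g.scale sum_distrib_right flip: scale_mult_left)
  also have "(\<Sum>w\<in>T'. scale (c w) (pair_word w)) = (\<Sum>w\<in>T. scale (c w) (pair_word w))"
    by (intro sum.mono_neutral_left) (auto simp: T'_def T)
  finally show False using w0 eq by (simp add: g.zero T'_def)
qed

lemma freely_generate: "freely_generate_pair scale u v"
  unfolding freely_generate_pair_def
proof (rule injI)
  let ?ev = "free_algebra_eval scale (\<lambda>b. if b then u else v)"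
  fix p p' :: "bool free_monoid \<Rightarrow>\<^sub>0 'k"
  assume eq: "?ev p = ?ev p'"
  define S where "S = Poly_Mapping.keys p \<union> Poly_Mapping.keys p'"
  have S: "finite S" by (simp add: S_def)
  have ev: "?ev r = (\<Sum>w\<in>S. scale (Poly_Mapping.lookup r w) (pair_word (letters w)))"
    if "Poly_Mapping.keys r \<subseteq> S" for r
    unfolding free_algebra_eval_def pm_extend_def using S that
    by (intro sum.mono_neutral_left) (auto simp: in_keys_iff)
  define c where "c = (\<lambda>w. Poly_Mapping.lookup p (Word w) - Poly_Mapping.lookup p' (Word w))"
  have inj: "inj_on letters S" by (rule inj_onI) (simp add: free_monoid.expand)
  have "(\<Sum>w\<in>letters ` S. scale (c w) (pair_word w)) = ?ev p - ?ev p'"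
    by (subst sum.reindex[OF inj])
       (simp add: ev S_def c_def scale_left_diff_distrib sum_subtractf)
  then have c: "\<forall>w\<in>letters ` S. c w = 0"
    using eq S by (intro pair_words_indep) auto
  show "p = p'"
  proof (rule poly_mapping_eqI)
    fix w
    show "Poly_Mapping.lookup p w = Poly_Mapping.lookup p' w"
    proof (cases "w \<in> S")
      case True
      then show ?thesis using c by (auto simp: c_def)
    next
      case False
      then show ?thesis by (simp add: S_def in_keys_iff)
    qed
  qed
qed

end


section \<open>Free pairs in algebras containing a group algebra\<close>

primrec nat_mult :: "nat \<Rightarrow> 'g::monoid_add \<Rightarrow> 'g" where
  "nat_mult 0 g = 0"
| "nat_mult (Suc n) g = g + nat_mult n g"

lemma poly_eval_hom_commute:
  assumes "unital_hom \<phi>" "\<And>a. z * \<phi> a = \<phi> a * z" "z * t = t * z"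
  shows "z * poly_eval_hom \<phi> t p = poly_eval_hom \<phi> t p * z"
proof (induction p)
  case 0
  then show ?case by (simp add: poly_eval_hom_0 assms(1))
next
  case (pCons a p)
  have "z * (poly_eval_hom \<phi> t p * t) = poly_eval_hom \<phi> t p * (z * t)"
    using pCons.IH by (simp flip: mult.assoc)
  then show ?case
    by (simp add: poly_eval_hom_pCons assms distrib_left distrib_right mult.assoc)
qed

lemma lift_fract_commute:
  assumes "inj_hom \<phi>" "\<And>a. z * \<phi> a = \<phi> a * z"
  shows "z * lift_fract \<phi> f = lift_fract \<phi> f * z"
proof (cases f)
  case (Fract r s)
  have "z * inverse (\<phi> s) = inverse (\<phi> s) * z" by (rule commute_inverse) (rule assms(2))
  moreover have "z * (\<phi> r * inverse (\<phi> s)) = \<phi> r * (z * inverse (\<phi> s))"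
    using assms(2) by (simp flip: mult.assoc)
  ultimately show ?thesis
    using Fract by (simp add: inj_hom.lift_fract_Fract[OF assms(1)] mult.assoc)
qed

locale group_algebra_embedding =
  fixes scale :: "'k::field \<Rightarrow> 'd::division_ring \<Rightarrow> 'd"
    and \<iota> :: "('g::group_add \<Rightarrow>\<^sub>0 'k) \<Rightarrow> 'd"
  assumes hom: "k_algebra_hom pm_scale scale \<iota>" and inj: "inj \<iota>"
begin

sublocale k_algebra scale using hom by (simp add: k_algebra_hom_def)

sublocale \<iota>: Vector_Spaces.linear pm_scale scale \<iota> using hom by (simp add: k_algebra_hom_def)

definition e :: "'g \<Rightarrow> 'd" where "e g = \<iota> (Poly_Mapping.single g 1)"

lemma e_zero: "e 0 = 1"
  using hom by (simp add: e_def k_algebra_hom_def)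

lemma e_add: "e (g + h) = e g * e h"
proof -
  have "e g * e h = \<iota> (Poly_Mapping.single g 1 * Poly_Mapping.single h 1)"
    using hom by (simp add: e_def k_algebra_hom_def)
  then show ?thesis by (simp add: e_def mult_single)
qed

lemma e_nat_mult: "e (nat_mult n g) = e g ^ n"
  by (induction n) (simp_all add: e_zero e_add)

lemma pm_scale_single: "pm_scale c (Poly_Mapping.single g 1) = Poly_Mapping.single g c"
  by (simp add: pm_scale_def)

lemma e_indep:
  assumes "finite S" "(\<Sum>g\<in>S. scale (c g) (e g)) = 0" "g \<in> S"
  shows "c g = 0"
proof -
  have "(\<Sum>g\<in>S. scale (c g) (e g)) = \<iota> (\<Sum>g\<in>S. Poly_Mapping.single g (c g))"
    by (simp add: e_def \<iota>.sum pm_scale_single flip: \<iota>.scale)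
  then have "\<iota> (\<Sum>g\<in>S. Poly_Mapping.single g (c g)) = \<iota> 0"
    using assms(2) by (simp add: \<iota>.zero)
  then have "(\<Sum>g\<in>S. Poly_Mapping.single g (c g)) = 0" by (rule injD[OF inj])
  then have "Poly_Mapping.lookup (\<Sum>g\<in>S. Poly_Mapping.single g (c g)) g = 0" by simp
  moreover have "Poly_Mapping.lookup (\<Sum>g\<in>S. Poly_Mapping.single g (c g)) g = c g"
    using assms by (simp add: lookup_sum lookup_single when_def)
  ultimately show ?thesis by simp
qed

lemma e_inj: "e g = e h \<Longrightarrow> g = h"
proof (rule ccontr)
  assume "e g = e h" "g \<noteq> h"
  then have "(\<Sum>f\<in>{g, h}. scale (if f = g then 1 else - 1) (e f)) = 0" by simp
  from e_indep[OF _ this, of g] show False by simp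
qed

definition bump :: "'g \<Rightarrow> 'd" where
  "bump g = inverse (1 - e g) * inverse (1 - e g) - inverse (1 - e g)"

text \<open>
  The shape of \<^const>\<open>bump\<close> is chosen so that it takes the same value \<open>g / (1 - g)\<^sup>2\<close> at
  \<open>g\<close> and at its inverse.
\<close>

lemma bump_symmetric:
  assumes invol: "k_involution scale star" and e: "\<And>g. star (e g) = e (\<tau> g)"
    and \<tau>: "\<tau> g = g \<or> \<tau> g = - g" and \<tau>0: "\<tau> 0 = 0" and "g \<noteq> 0"
  shows "star (bump g) = bump g"
proof -
  interpret star: Vector_Spaces.linear scale scale star using invol by (simp add: k_involution_def)
  have mult: "star (a * b) = star b * star a" for a b using invol by (simp add: k_involution_def)
  have one: "star 1 = 1" using e[of 0] by (simp add: \<tau>0 e_zero)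
  have nz: "1 - e g \<noteq> 0" using e_inj[of 0 g] \<open>g \<noteq> 0\<close> by (auto simp: e_zero)
  have "star (1 - e g) * star (inverse (1 - e g)) = 1"
    using nz by (simp add: one flip: mult)
  then have inv: "star (inverse (1 - e g)) = inverse (1 - e (\<tau> g))"
    by (simp add: star.diff one e inverse_unique)
  define b where "b = inverse (1 - e g)"
  have b: "b = 1 + e g * b" using right_inverse[OF nz] by (simp add: b_def algebra_simps)
  \<comment> \<open>Inverting the group element turns \<open>b\<close> into \<open>1 - b\<close>,
    and \<open>b * b - b\<close> is invariant under this exchange.\<close>
  have "star b = b \<or> star b = 1 - b"
    using \<tau>
  proof
    assume "\<tau> g = - g"
    have "(1 - e (- g)) * (1 - b) = (1 - e (- g)) * - (e g * b)"
      using b by (metis add_diff_cancel_left' minus_diff_eq)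
    also have "\<dots> = e (- g) * e g * b - e g * b" by (simp add: left_diff_distrib mult.assoc)
    also have "\<dots> = 1" using b by (simp flip: e_add) (metis add_diff_cancel_right' e_zero mult_1_left)
    finally show ?thesis using inv \<open>\<tau> g = - g\<close> by (simp add: b_def inverse_unique)
  qed (simp add: b_def inv)
  then have "star (b * b - b) = b * b - b"
  proof
    assume s: "star b = 1 - b"
    have "star (b * b - b) = (1 - b) * (1 - b) - (1 - b)" by (simp only: star.diff mult s)
    also have "\<dots> = b * b - b" by (simp add: algebra_simps)
    finally show ?thesis .
  qed (simp add: star.diff mult)
  then show ?thesis by (simp add: bump_def b_def)
qed

text \<open>The maps \<open>\<phi>0\<close>, \<open>\<phi>1\<close>, \<open>\<phi>2\<close>,
  \<open>\<phi>3\<close>, \<open>\<Psi>\<close> embed the tower k, k[w], k(w), k(w)[x], k(w)(x).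
  Independence of the monomials in \<open>W\<close>, \<open>X\<close>, \<open>Y\<close> over k comes
  from \<open>distinct\<close>; each polynomial stage absorbs one variable, until only the powers of
  \<open>Y\<close> remain.\<close>

lemma freely_generate_bumps:
  assumes central: "\<And>g. w + g = g + w" and yx: "y + x = w + (x + y)"
    and distinct: "inj (\<lambda>(j, i, l). nat_mult j w + (nat_mult i x + nat_mult l y))"
  shows "freely_generate_pair scale (bump x) (bump y)"
proof -
  define X Y W where "X = e x" and "Y = e y" and "W = e w"
  define \<phi>0 where "\<phi>0 = (\<lambda>c. scale c 1)"
  define \<phi>1 where "\<phi>1 = poly_eval_hom \<phi>0 W"
  define \<phi>2 where "\<phi>2 = lift_fract \<phi>1"
  define \<phi>3 where "\<phi>3 = poly_eval_hom \<phi>2 X"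
  define \<Psi> where "\<Psi> = lift_fract \<phi>3"
  have \<phi>0_mult: "\<phi>0 c * z = scale c z" for c z by (simp add: \<phi>0_def flip: scale_mult_left)
  have \<phi>0_comm: "z * \<phi>0 c = \<phi>0 c * z" for c z
    by (simp add: \<phi>0_def flip: scale_mult_left scale_mult_right)
  have WX: "W * X = X * W" and WY: "W * Y = Y * W"
    using central by (simp_all add: W_def X_def Y_def flip: e_add)
  have YX: "Y * X = W * X * Y" using yx by (simp add: W_def X_def Y_def add.assoc flip: e_add)

  interpret \<phi>0: unital_hom \<phi>0
    by standard (simp_all add: \<phi>0_def scale_left_distrib flip: scale_mult_left)
  have "left_indep \<phi>0 (\<lambda>(j, p). W ^ j * (case p of (i, l) \<Rightarrow> X ^ i * Y ^ l))"
    unfolding left_indep_def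
  proof (intro allI impI ballI)
    fix S c and p :: "nat \<times> nat \<times> nat"
    let ?m = "\<lambda>(j, p). W ^ j * (case p of (i, l) \<Rightarrow> X ^ i * Y ^ l)"
    let ?g = "\<lambda>(j, i, l). nat_mult j w + (nat_mult i x + nat_mult l y)"
    assume S: "finite S" and eq: "(\<Sum>p\<in>S. \<phi>0 (c p) * ?m p) = 0" and p: "p \<in> S"
    have "?m p = e (?g p)" for p
      by (cases p) (simp add: e_add e_nat_mult X_def Y_def W_def)
    then have "(\<Sum>p\<in>S. scale (c p) (e (?g p))) = 0" using eq by (simp only: \<phi>0_mult)
    moreover have inj: "inj_on ?g S" using distinct by (rule inj_on_subset) simp
    ultimately have "(\<Sum>h\<in>?g ` S. scale (c (the_inv_into S ?g h)) (e h)) = 0"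
      by (subst sum.reindex) (simp_all add: the_inv_into_f_f)
    from e_indep[OF _ this, of "?g p"] have "c (the_inv_into S ?g (?g p)) = 0" using S p by blast
    then show "c p = 0" by (simp only: the_inv_into_f_f[OF inj p])
  qed
  then have ind1: "left_indep \<phi>1 (\<lambda>(i, l). X ^ i * Y ^ l)"
    unfolding \<phi>1_def by (rule left_indep_poly_eval_hom[OF \<phi>0.unital_hom_axioms])
  have "unital_hom \<phi>1"
    unfolding \<phi>1_def by (rule unital_hom_poly_eval_hom[OF \<phi>0.unital_hom_axioms]) (simp add: \<phi>0_comm)
  then interpret \<phi>1: inj_hom \<phi>1
    using left_indep_inj[OF _ ind1] by (simp add: inj_hom_def inj_hom_axioms_def)
  have comm1: "z * \<phi>1 p = \<phi>1 p * z" if "z * W = W * z" for z p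
    unfolding \<phi>1_def using \<phi>0.unital_hom_axioms \<phi>0_comm that by (rule poly_eval_hom_commute)
  have ind2: "left_indep \<phi>2 (\<lambda>(i, l). X ^ i * Y ^ l)"
    unfolding \<phi>2_def by (rule \<phi>1.left_indep_lift_fract[OF ind1])
  interpret \<phi>2: unital_hom \<phi>2 unfolding \<phi>2_def by (rule \<phi>1.unital_hom_lift_fract)
  have comm2: "z * \<phi>2 f = \<phi>2 f * z" if "z * W = W * z" for z f
    unfolding \<phi>2_def using \<phi>1.inj_hom_axioms comm1[OF that] by (rule lift_fract_commute)
  have ind3: "left_indep \<phi>3 (\<lambda>l. Y ^ l)"
    unfolding \<phi>3_def by (rule left_indep_poly_eval_hom[OF \<phi>2.unital_hom_axioms ind2])
  have "unital_hom \<phi>3"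
    unfolding \<phi>3_def by (rule unital_hom_poly_eval_hom[OF \<phi>2.unital_hom_axioms]) (simp add: comm2 WX)
  then interpret \<phi>3: inj_hom \<phi>3
    using left_indep_inj[OF _ ind3] by (simp add: inj_hom_def inj_hom_axioms_def)
  have ind4: "left_indep \<Psi> (\<lambda>l. Y ^ l)"
    unfolding \<Psi>_def by (rule \<phi>3.left_indep_lift_fract[OF ind3])
  interpret \<Psi>: unital_hom \<Psi> unfolding \<Psi>_def by (rule \<phi>3.unital_hom_lift_fract)

  \<comment> \<open>The commutator as the variable of k(w); its powers are monomials of growing
    degree, so it has infinite order.\<close>
  define q :: "'k poly fract" where "q = to_fract [:0, 1:]"
  have "q ^ n = to_fract (monom 1 n)" for n
    by (induction n) (simp_all add: q_def monom_Suc monom_0 one_pCons flip: to_fract_1 to_fract_mult)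
  then have q_power: "q ^ n \<noteq> 1" if "n > 0" for n
    using that degree_monom_eq[of "1 :: 'k" n] by (auto simp flip: to_fract_1)
  have "q \<noteq> 0" by (simp add: q_def)
  then interpret q: q_scaling q using q_power by unfold_locales
  have \<phi>2_q: "\<phi>2 q = W"
    unfolding \<phi>2_def q_def \<phi>1.lift_fract_to_fract
    by (simp add: \<phi>1_def poly_eval_hom_pCons poly_eval_hom_0 \<phi>0.unital_hom_axioms \<phi>0.zero \<phi>0.one)
  note pc3 = poly_eval_hom_pCons[OF \<phi>2.unital_hom_axioms, of X, folded \<phi>3_def]
  have const3: "\<phi>3 [:c:] = \<phi>2 c" for c by (simp add: pc3 \<phi>3.zero)
  have qx3: "\<phi>3 [:0, q:] = W * X" by (simp add: pc3 \<phi>3.zero \<phi>2_q \<phi>2.zero)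
  \<comment> \<open>On polynomials this is \<open>Y * X = W * X * Y\<close> with \<open>W\<close>
    commuting with \<open>X\<close> and \<open>Y\<close>; inverting denominators extends it to
    fractions.\<close>
  have skew3: "Y * \<phi>3 p = \<phi>3 (pcompose p [:0, q:]) * Y" for p
  proof (induction p)
    case (pCons c p)
    have "Y * \<phi>3 (pCons c p) = \<phi>2 c * Y + \<phi>3 (pcompose p [:0, q:]) * (Y * X)"
      using pCons.IH by (simp add: pc3 distrib_left comm2 WY flip: mult.assoc)
    also have "\<dots> = (\<phi>3 [:c:] + \<phi>3 (pcompose p [:0, q:] * [:0, q:])) * Y"
      by (simp only: YX const3 \<phi>3.mult qx3 distrib_right mult.assoc)
    also have "\<dots> = \<phi>3 (pcompose (pCons c p) [:0, q:]) * Y"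
      by (simp only: pcompose_pCons \<phi>3.add mult.commute)
    finally show ?case .
  qed (simp add: \<phi>3.zero)
  have skew: "Y * \<Psi> f = \<Psi> (sigma q f) * Y" for f
  proof (cases f)
    case (Fract r s)
    let ?s = "pcompose s [:0, q:]"
    have nz: "?s \<noteq> 0" using Fract \<open>q \<noteq> 0\<close> by (simp add: pcompose_scale_eq_0_iff)
    have "Y * inverse (\<phi>3 s) = inverse (\<phi>3 ?s) * (\<phi>3 ?s * Y) * inverse (\<phi>3 s)"
      using nz by (simp add: \<phi>3.eq_0_iff flip: mult.assoc)
    also have "\<dots> = inverse (\<phi>3 ?s) * Y"
      using Fract by (simp add: \<phi>3.eq_0_iff mult.assoc flip: skew3)
    finally have inv: "Y * inverse (\<phi>3 s) = inverse (\<phi>3 ?s) * Y" .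
    have "Y * \<Psi> f = Y * \<phi>3 r * inverse (\<phi>3 s)"
      using Fract by (simp add: \<Psi>_def \<phi>3.lift_fract_Fract mult.assoc)
    also have "\<dots> = \<phi>3 (pcompose r [:0, q:]) * inverse (\<phi>3 ?s) * Y"
      by (simp only: skew3 inv mult.assoc)
    also have "\<phi>3 (pcompose r [:0, q:]) * inverse (\<phi>3 ?s) = \<Psi> (sigma q f)"
      using Fract nz \<open>q \<noteq> 0\<close> by (simp add: \<Psi>_def sigma_Fract \<phi>3.lift_fract_Fract)
    finally show ?thesis .
  qed

  define \<kappa> :: "'k \<Rightarrow> 'k poly fract poly fract" where "\<kappa> = (\<lambda>c. to_fract [:to_fract [:c:]:])"
  have \<Psi>_\<kappa>: "\<Psi> (\<kappa> c) = \<phi>0 c" for c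
    by (simp add: \<Psi>_def \<kappa>_def \<phi>3.lift_fract_to_fract const3 \<phi>2_def \<phi>1.lift_fract_to_fract)
       (simp add: \<phi>1_def poly_eval_hom_def)
  interpret words: skew_words_algebra scale \<Psi> "sigma q" Y q.letter \<kappa>
  proof
    show "\<forall>i\<in>T. c i = 0"
      if "finite T" "\<And>i. i \<in> T \<Longrightarrow> sigma q (c i) = c i"
        "(\<Sum>i\<in>T. c i * q.letter ^ i) = sigma q g - g" for T c g
      using that by (rule q.letter_powers_indep)
    show "sigma q (\<kappa> c) = \<kappa> c" for c
      by (simp add: sigma_def \<kappa>_def inj_hom.lift_fract_to_fract[OF inj_hom_sigma] \<open>q \<noteq> 0\<close>)
    show "scale c z = \<Psi> (\<kappa> c) * z" for c z by (simp add: \<Psi>_\<kappa> \<phi>0_mult)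
  qed (simp_all add: skew ind4 \<kappa>_def)
  have "\<Psi> (to_fract [:0, 1:]) = X"
    by (simp add: \<Psi>_def \<phi>3.lift_fract_to_fract pc3 \<phi>3.zero \<phi>2.zero \<phi>2.one)
  then have "words.u = bump x"
    unfolding words.u_def unfolding q.letter_def
    by (simp add: bump_def \<Psi>.diff \<Psi>.mult \<Psi>.one X_def power2_eq_square
          unital_hom_inverse[OF \<Psi>.unital_hom_axioms])
  moreover have "words.v = bump y"
    unfolding words.v_def unfolding words.B_def by (simp add: bump_def Y_def)
  ultimately show ?thesis using words.freely_generate by simp
qed

end

section \<open>Symmetric elements of the Heisenberg group\<close>

lift_definition heis_x :: heis is GenX .
lift_definition heis_y :: heis is GenY .

lemma heis_induct:
  assumes "P heis_x" "P heis_y" "P 0" "\<And>g h. P g \<Longrightarrow> P h \<Longrightarrow> P (g + h)" "\<And>g. P g \<Longrightarrow> P (- g)"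
  shows "P g"
proof -
  have "P (abs_heis t)" for t
  proof (induction t)
    case GenX
    then show ?case using assms(1) by (simp add: heis_x_def)
  next
    case GenY
    then show ?case using assms(2) by (simp add: heis_y_def)
  next
    case GOne
    then show ?case using assms(3) by (simp add: zero_heis_def)
  next
    case (GMult s t)
    then show ?case using assms(4) by (simp flip: plus_heis.abs_eq)
  next
    case (GInv t)
    then show ?case using assms(5) by (simp flip: uminus_heis.abs_eq)
  qed
  then show ?thesis by (induction g rule: heis.abs_induct) simp
qed

text \<open>
  A triple \<open>(a, b, c)\<close> stands for \<open>x\<^sup>a y\<^sup>b [y, x]\<^sup>c\<close>.
\<close>

primrec triple :: "heis_term \<Rightarrow> int \<times> int \<times> int" where
  "triple GenX = (1, 0, 0)"
| "triple GenY = (0, 1, 0)"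
| "triple GOne = (0, 0, 0)"
| "triple (GMult s t) = (case (triple s, triple t) of ((a, b, c), (a', b', c')) \<Rightarrow>
     (a + a', b + b', c + c' + b * a'))"
| "triple (GInv s) = (case triple s of (a, b, c) \<Rightarrow> (- a, - b, a * b - c))"

text \<open>The multiplication rule is that of unitriangular integer 3 by 3 matrices. Since the
  relations hold there, the coordinates are invariants that can tell group elements apart.\<close>

lift_definition heis_triple :: "heis \<Rightarrow> int \<times> int \<times> int" is triple
proof -
  fix s t assume "heis_eq s t"
  then show "triple s = triple t"
    by (induction rule: heis_eq.induct)
       (auto simp: comm_term_def algebra_simps split: prod.splits)
qed

definition coord_x :: "heis \<Rightarrow> int" where "coord_x g = fst (heis_triple g)"
definition coord_y :: "heis \<Rightarrow> int" where "coord_y g = fst (snd (heis_triple g))"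
definition coord_z :: "heis \<Rightarrow> int" where "coord_z g = snd (snd (heis_triple g))"

lemma heis_triple_add:
  "heis_triple (g + h) = (case (heis_triple g, heis_triple h) of ((a, b, c), (a', b', c')) \<Rightarrow>
     (a + a', b + b', c + c' + b * a'))"
  by transfer simp

lemma coord_add:
  "coord_x (g + h) = coord_x g + coord_x h"
  "coord_y (g + h) = coord_y g + coord_y h"
  "coord_z (g + h) = coord_z g + coord_z h + coord_y g * coord_x h"
  by (simp_all add: coord_x_def coord_y_def coord_z_def heis_triple_add split: prod.splits)

lemma heis_triple_generators:
  "heis_triple heis_x = (1, 0, 0)" "heis_triple heis_y = (0, 1, 0)" "heis_triple 0 = (0, 0, 0)"
  by (transfer; simp)+

lemma coord_generators:
  "coord_x heis_x = 1" "coord_y heis_x = 0" "coord_x heis_y = 0" "coord_y heis_y = 1"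
  "coord_x 0 = 0" "coord_y 0 = 0" "coord_z 0 = 0"
  by (simp_all add: coord_x_def coord_y_def coord_z_def heis_triple_generators)

lemma coord_uminus: "coord_x (- g) = - coord_x g" "coord_y (- g) = - coord_y g"
  using coord_add(1,2)[of g "- g"] by (simp_all add: coord_generators)

lemma coord_nat_mult:
  "coord_x (nat_mult n g) = int n * coord_x g" "coord_y (nat_mult n g) = int n * coord_y g"
  by (induction n) (simp_all add: coord_generators coord_add algebra_simps)

section \<open>Nilpotency of class two\<close>

definition central :: "'g::group_add \<Rightarrow> bool" where
  "central c \<longleftrightarrow> (\<forall>h. c + h = h + c)"

text \<open>Centrality of the commutator of \<open>g\<close> and \<open>h\<close>, phrased without
  inverses.\<close>

definition commute_mod_center :: "'g::group_add \<Rightarrow> 'g \<Rightarrow> bool" where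
  "commute_mod_center g h \<longleftrightarrow> (\<exists>c. central c \<and> g + h = c + (h + g))"

lemma central_uminus: "central c \<Longrightarrow> central (- c)"
  unfolding central_def
  by (metis add.inverse_inverse minus_add)

lemma commute_mod_center_sym:
  assumes "commute_mod_center g h"
  shows "commute_mod_center h g"
proof -
  obtain c where c: "central c" "g + h = c + (h + g)" using assms by (auto simp: commute_mod_center_def)
  then have "h + g = - c + (g + h)" by (simp add: add.assoc[symmetric])
  then show ?thesis using central_uminus[OF c(1)] by (auto simp: commute_mod_center_def)
qed

text \<open>Closure under the group operations lets the property spread from the generators by
  \<open>heis_induct\<close>.\<close>

lemma commute_mod_center_add:
  assumes "commute_mod_center g h" "commute_mod_center g h'"
  shows "commute_mod_center g (h + h')"
proof -
  obtain c where c: "central c" "g + h = c + (h + g)"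
    using assms(1) by (auto simp: commute_mod_center_def)
  obtain c' where c': "central c'" "g + h' = c' + (h' + g)"
    using assms(2) by (auto simp: commute_mod_center_def)
  have "g + (h + h') = c + (h + g) + h'" using c(2) by (simp flip: add.assoc)
  also have "\<dots> = c + (h + (g + h'))" by (simp add: add.assoc)
  also have "\<dots> = c + ((h + c') + (h' + g))" by (simp add: c'(2) add.assoc)
  also have "h + c' = c' + h" using c'(1) by (simp add: central_def)
  finally have "g + (h + h') = c + c' + (h + h' + g)" by (simp add: add.assoc)
  moreover have "central (c + c')"
    using c(1) c'(1) unfolding central_def by (metis add.assoc)
  ultimately show ?thesis by (auto simp: commute_mod_center_def)
qed

lemma commute_mod_center_uminus:
  assumes "commute_mod_center g h"
  shows "commute_mod_center g (- h)"
proof -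
  obtain c where c: "central c" "g + h = c + (h + g)" using assms by (auto simp: commute_mod_center_def)
  have "- h + g = - h + (g + h) + - h"
    by (simp only: add.assoc right_minus add_0_right)
  also have "\<dots> = - h + (c + h) + (g + - h)" by (simp only: c(2) add.assoc)
  also have "c + h = h + c" using c(1) by (simp add: central_def)
  finally have "- h + g = c + (g + - h)" by (simp add: add.assoc)
  then have "commute_mod_center (- h) g" using c(1) by (auto simp: commute_mod_center_def)
  then show ?thesis by (rule commute_mod_center_sym)
qed

text \<open>The defining relations say that the commutator \<open>z\<close> of the generators
  commutes with both of them, so it is central. The property therefore holds for the two generators
  and extends to all elements in each argument by induction.\<close>

lemma heis_commute_mod_center:
  fixes g h :: heis
  shows "commute_mod_center g h"
proof -
  define z where "z = - heis_x + - heis_y + heis_x + heis_y"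
  have rel: "- z + - heis_x + z + heis_x = 0" "- z + - heis_y + z + heis_y = 0"
    unfolding z_def
    by (transfer, use heis_eq.rel_x in \<open>simp add: comm_term_def\<close>)
       (transfer, use heis_eq.rel_y in \<open>simp add: comm_term_def\<close>)
  have comm: "z + t = t + z" if "- z + - t + z + t = 0" for t
  proof -
    have "z + t = t + z + (- z + - t + z + t)"
      by (simp only: add.assoc add_minus_cancel)
    then show ?thesis using that by simp
  qed
  have "z + h = h + z" for h
  proof (induction h rule: heis_induct)
    case (4 g h)
    then show ?case by (metis add.assoc)
  next
    case (5 g)
    then show ?case by (metis add.inverse_inverse minus_add add.assoc add_left_cancel left_minus)
  qed (use comm rel in auto)
  then have z: "central z" by (simp add: central_def)
  have "heis_x + heis_y = heis_y + heis_x + z"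
    by (simp only: z_def add.assoc add_minus_cancel)
  then have "heis_x + heis_y = z + (heis_y + heis_x)" using z by (simp add: central_def)
  then have xy: "commute_mod_center heis_x heis_y" using z by (auto simp: commute_mod_center_def)
  have triv: "commute_mod_center g g" "commute_mod_center g 0" for g :: heis
    by (auto simp: commute_mod_center_def central_def intro!: exI[of _ 0])
  have x: "commute_mod_center heis_x h" for h
    by (induction h rule: heis_induct)
       (auto intro: triv xy commute_mod_center_add commute_mod_center_uminus)
  have y: "commute_mod_center heis_y h" for h
    by (induction h rule: heis_induct)
       (auto intro: triv commute_mod_center_sym[OF x] commute_mod_center_add commute_mod_center_uminus)
  show ?thesis
    by (induction h rule: heis_induct)
       (auto intro: triv commute_mod_center_sym[OF x] commute_mod_center_sym[OF y]
          commute_mod_center_add commute_mod_center_uminus)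
qed

section \<open>Elements fixed or inverted by an involution\<close>

lemma involution_zero:
  assumes "group_involution \<tau>"
  shows "\<tau> 0 = 0"
  using assms unfolding group_involution_def by (metis add.right_neutral add_left_cancel)

lemma involution_uminus:
  assumes "group_involution \<tau>"
  shows "\<tau> (- g) = - \<tau> g"
proof -
  have "\<tau> (- g) + \<tau> g = \<tau> (g + - g)" using assms by (simp only: group_involution_def)
  then have "\<tau> (- g) + \<tau> g = 0" by (simp add: involution_zero[OF assms])
  then show ?thesis by (simp add: eq_neg_iff_add_eq_0)
qed

text \<open>The determinant of the images in the abelianization; it is also the central coordinate
  of the commutator of \<open>h\<close> and \<open>g\<close>.\<close>

definition heis_det :: "heis \<Rightarrow> heis \<Rightarrow> int" where
  "heis_det g h = coord_x g * coord_y h - coord_y g * coord_x h"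

text \<open>
  The elements \<open>g + \<tau> g\<close> are symmetric, and with \<open>h = g - \<tau> g\<close> the elements \<open>h - \<tau> h\<close> are
  inverted by \<open>\<tau>\<close>, as \<open>h\<close> and \<open>\<tau> h\<close> commute.  In the abelianization
  \<open>2 (g + \<tau> g) + (h - \<tau> h) = 4 g\<close>, so these elements cannot all be proportional.
\<close>

lemma involution_eigenvectors:
  fixes \<tau> :: "heis \<Rightarrow> heis"
  assumes inv: "group_involution \<tau>"
  shows "\<exists>x y. (\<tau> x = x \<or> \<tau> x = - x) \<and> (\<tau> y = y \<or> \<tau> y = - y) \<and> heis_det x y \<noteq> 0"
proof -
  have add: "\<tau> (g + h) = \<tau> h + \<tau> g" and idem: "\<tau> (\<tau> g) = g" for g h
    using inv by (simp_all add: group_involution_def)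
  note um = involution_uminus[OF inv]
  define p where "p = (\<lambda>g. g + \<tau> g)"
  define d where "d = (\<lambda>g. g + - \<tau> g)"
  define m where "m = (\<lambda>g. d g + - \<tau> (d g))"
  have p: "\<tau> (p g) = p g" for g by (simp add: p_def add idem)
  have \<tau>d: "\<tau> (d g) = - g + \<tau> g" for g by (simp only: d_def add um idem)
  have m: "\<tau> (m g) = - m g" for g
  proof -
    \<comment> \<open>The inverse of \<open>\<tau> (d g)\<close> is \<open>- \<tau> g + g\<close>,
      which differs from \<open>d g\<close> by a central element; hence \<open>d g\<close> and
      \<open>\<tau> (d g)\<close> commute.\<close>
    obtain c where c: "central c" "g + - \<tau> g = c + (- \<tau> g + g)"
      using heis_commute_mod_center[of g "- \<tau> g"] by (auto simp: commute_mod_center_def)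
    have "- \<tau> (d g) = - \<tau> g + g" by (simp only: \<tau>d minus_add minus_minus)
    then have "d g = c + - \<tau> (d g)" by (simp only: d_def c(2))
    then have "\<tau> (d g) + d g = d g + \<tau> (d g)"
      using c(1) unfolding central_def by (metis add.assoc left_minus right_minus add.right_neutral)
    then have "- d g + \<tau> (d g) = \<tau> (d g) + - d g"
      by (metis add.assoc left_minus right_minus add.right_neutral add.left_neutral)
    moreover have "\<tau> (m g) = - d g + \<tau> (d g)" by (simp only: m_def add um idem)
    ultimately show ?thesis by (simp add: m_def minus_add)
  qed
  have px: "coord_x (p g) = coord_x g + coord_x (\<tau> g)" "coord_y (p g) = coord_y g + coord_y (\<tau> g)" for g
    by (simp_all add: p_def coord_add)
  have mx: "coord_x (m g) = 2 * (coord_x g - coord_x (\<tau> g))"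
    "coord_y (m g) = 2 * (coord_y g - coord_y (\<tau> g))" for g
    unfolding m_def \<tau>d unfolding d_def coord_add coord_uminus by simp_all
  \<comment> \<open>In the abelianization \<open>2 p + m\<close> is multiplication by 4, so this is
    the bilinear expansion of a determinant equal to 16.\<close>
  have "4 * heis_det (p heis_x) (p heis_y) + 2 * heis_det (p heis_x) (m heis_y) +
      2 * heis_det (m heis_x) (p heis_y) + heis_det (m heis_x) (m heis_y) = 16"
    by (simp add: heis_det_def px mx coord_generators algebra_simps)
  then have "heis_det (p heis_x) (p heis_y) \<noteq> 0 \<or> heis_det (p heis_x) (m heis_y) \<noteq> 0 \<or>
      heis_det (m heis_x) (p heis_y) \<noteq> 0 \<or> heis_det (m heis_x) (m heis_y) \<noteq> 0"
    by auto
  then show ?thesis using p m by blast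
qed

text \<open>The commutator \<open>w\<close> has coordinates 0, 0 and \<open>heis_det x y\<close>.
  The first two coordinates of a product determine \<open>i\<close> and \<open>l\<close>, and the
  third then determines \<open>j\<close>.\<close>

lemma heis_independent_pair:
  assumes det: "heis_det x y \<noteq> 0"
  shows "\<exists>w. central w \<and> y + x = w + (x + y) \<and>
    inj (\<lambda>(j, i, l). nat_mult j w + (nat_mult i x + nat_mult l y))"
proof -
  obtain w where w: "central w" "y + x = w + (x + y)"
    using heis_commute_mod_center[of y x] by (auto simp: commute_mod_center_def)
  have wx: "coord_x w = 0" "coord_y w = 0"
    using arg_cong[OF w(2), of coord_x] arg_cong[OF w(2), of coord_y] by (simp_all add: coord_add)
  then have "coord_z w = heis_det x y"
    using arg_cong[OF w(2), of coord_z] by (simp add: coord_add heis_det_def algebra_simps)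
  then have wz: "coord_z w \<noteq> 0" using det by simp
  have wn: "coord_z (nat_mult j w) = int j * coord_z w" for j
    by (induction j) (simp_all add: coord_generators coord_add wx algebra_simps)
  have "(j, i, l) = (j', i', l')"
    if eq: "nat_mult j w + (nat_mult i x + nat_mult l y) =
      nat_mult j' w + (nat_mult i' x + nat_mult l' y)" for j i l j' i' l'
  proof -
    define a b where "a = int i - int i'" and "b = int l - int l'"
    have 1: "a * coord_x x + b * coord_x y = 0" "a * coord_y x + b * coord_y y = 0"
      using arg_cong[OF eq, of coord_x] arg_cong[OF eq, of coord_y]
      by (simp_all add: coord_add coord_nat_mult wx a_def b_def algebra_simps)
    \<comment> \<open>Cramer's rule for the linear system in \<open>a\<close> and
      \<open>b\<close>.\<close>
    have "a * heis_det x y = (a * coord_x x + b * coord_x y) * coord_y y -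
        (a * coord_y x + b * coord_y y) * coord_x y"
      "b * heis_det x y = (a * coord_y x + b * coord_y y) * coord_x x -
        (a * coord_x x + b * coord_x y) * coord_y x"
      by (simp_all add: heis_det_def algebra_simps)
    then have "a * heis_det x y = 0" "b * heis_det x y = 0" unfolding 1 by simp_all
    then have "a = 0" "b = 0" using det by simp_all
    then have il: "i = i'" "l = l'" by (simp_all add: a_def b_def)
    then have "int j * coord_z w = int j' * coord_z w"
      using arg_cong[OF eq, of coord_z] by (simp add: coord_add wn coord_nat_mult wx)
    then show ?thesis using il wz by simp
  qed
  then show ?thesis using w by (auto simp: inj_def)
qed

theorem theorem1p2:
  fixes scale :: "'k::field \<Rightarrow> 'd::division_ring \<Rightarrow> 'd"
    and \<iota> :: "(heis \<Rightarrow>\<^sub>0 'k) \<Rightarrow> 'd"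
    and star :: "'d \<Rightarrow> 'd"
  assumes "ore_fractions scale \<iota>"
    and "induced_involution scale \<iota> star"
  shows "\<exists>u v. star u = u \<and> star v = v \<and> freely_generate_pair scale u v"
proof -
  interpret group_algebra_embedding scale \<iota>
    using assms(1) by unfold_locales (simp_all add: ore_fractions_def)
  obtain \<tau> where \<tau>: "group_involution \<tau>" and star_\<iota>:
      "\<And>p. star (\<iota> p) = \<iota> (pm_extend pm_scale (\<lambda>g. Poly_Mapping.single (\<tau> g) 1) p)"
    using assms(2) by (auto simp: induced_involution_def)
  have star: "k_involution scale star" using assms(2) by (simp add: induced_involution_def)
  have star_e: "star (e g) = e (\<tau> g)" for g
    by (simp add: e_def star_\<iota> pm_extend_def pm_scale_single)
  obtain x y where xy: "\<tau> x = x \<or> \<tau> x = - x" "\<tau> y = y \<or> \<tau> y = - y" "heis_det x y \<noteq> 0"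
    using involution_eigenvectors[OF \<tau>] by blast
  \<comment> \<open>Nontriviality makes \<open>1 - e x\<close> and \<open>1 - e y\<close>
    invertible, as \<open>bump_symmetric\<close> requires.\<close>
  then have nz: "x \<noteq> 0" "y \<noteq> 0" by (auto simp: heis_det_def coord_generators)
  obtain w where "central w" "y + x = w + (x + y)"
      "inj (\<lambda>(j, i, l). nat_mult j w + (nat_mult i x + nat_mult l y))"
    using heis_independent_pair[OF xy(3)] by blast
  then have "freely_generate_pair scale (bump x) (bump y)"
    by (intro freely_generate_bumps) (simp_all add: central_def)
  moreover have "star (bump x) = bump x" "star (bump y) = bump y"
    using bump_symmetric[OF star star_e _ involution_zero[OF \<tau>]] xy nz by blast+
  ultimately show ?thesis by blast
qed

end
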